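(* Fix an integer $\ell\ge 3$. For every $0<\alpha_0\le 1/\ell$ there exist $\beta,\gamma>0$ and $C>0$ such that for every $\alpha$ with $\alpha_0\le\alpha\le 1/\ell$ the following holds. Let $G$ be an $n$-vertex graph with minimum degree $\delta(G)\ge(\alpha-\gamma)n$ that is $(\alpha,\beta)$-stable. If $p\ge C\log n/n$, then asymptotically almost surely $G\cup G(n,p)$ contains $\min\{\delta(G),\lfloor \alpha n\rfloor\}$ pairwise vertex-disjoint copies of $C_\ell$.
   Context: For $0<\beta<\alpha<1/2$, an $n$-vertex graph $G$ is called $(\alpha,\beta)$-stable if there is a partition $V(G)=A\cup B$ with $(\alpha-\beta)n \le |A| \le (\alpha+\beta)n$ and $(1-\alpha-\beta)n \le |B| \le (1-\alpha+\beta)n$ such that: the bipartite subgraph $G[A,B]$ (vertex set $A\cup B$, edges of $G$ between $A$ and $B$) has minimum degree at least $\alpha n/4$; all but at most $\beta n$ vertices of $A$ have at least $|B|-\beta n$ neighbours in $B$; all but at most $\beta n$ vertices of $B$ have at least $|A|-\beta n$ neighbours in $A$; and $G[B]$ has at most $\beta n^2$ edges. $C_\ell$ is the cycle on $\ell$ vertices. $G(n,p)$ is the binomial random graph on $V(G)$ (each pair an edge independently with probability $p$), and $G\cup G(n,p)$ has as edge set the union of both edge sets. "Asymptotically almost surely" means with probability tending to $1$ as $n\to\infty$, for any sequence $G=G_n$ satisfying the hypotheses. *)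

theory Defs
  imports Complex_Main
begin

definition all_pairs :: "nat \<Rightarrow> nat set set" where
  "all_pairs n = {e. \<exists>x y. x < n \<and> y < n \<and> x \<noteq> y \<and> e = {x, y}}"

definition is_graph :: "nat \<Rightarrow> nat set set \<Rightarrow> bool" where
  "is_graph n E \<longleftrightarrow> E \<subseteq> all_pairs n"

definition nbhd :: "nat set set \<Rightarrow> nat \<Rightarrow> nat set" where
  "nbhd E v = {u. {v, u} \<in> E}"

definition degree :: "nat set set \<Rightarrow> nat \<Rightarrow> nat" where
  "degree E v = card (nbhd E v)"

definition min_degree :: "nat \<Rightarrow> nat set set \<Rightarrow> nat" where
  "min_degree n E = Min (degree E ` {..<n})"

definition stable :: "nat \<Rightarrow> nat set set \<Rightarrow> real \<Rightarrow> real \<Rightarrow> bool" where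
  "stable n E \<alpha> \<beta> \<longleftrightarrow>
     (\<exists>A B. A \<union> B = {..<n} \<and> A \<inter> B = {} \<and>
        (\<alpha> - \<beta>) * real n \<le> real (card A) \<and> card A \<le> (\<alpha> + \<beta>) * real n \<and>
        (1 - \<alpha> - \<beta>) * real n \<le> real (card B) \<and> card B \<le> (1 - \<alpha> + \<beta>) * real n \<and>
        (\<forall>v\<in>A. real (card (nbhd E v \<inter> B)) \<ge> \<alpha> * real n / 4) \<and>
        (\<forall>v\<in>B. real (card (nbhd E v \<inter> A)) \<ge> \<alpha> * real n / 4) \<and>
        real (card {v\<in>A. real (card (nbhd E v \<inter> B)) < real (card B) - \<beta> * real n}) \<le> \<beta> * real n \<and>
        real (card {v\<in>B. real (card (nbhd E v \<inter> A)) < real (card A) - \<beta> * real n}) \<le> \<beta> * real n \<and>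
        real (card {e\<in>E. e \<subseteq> B}) \<le> \<beta> * (real n) ^ 2)"

definition is_cycle :: "nat set set \<Rightarrow> nat \<Rightarrow> nat list \<Rightarrow> bool" where
  "is_cycle E l c \<longleftrightarrow> length c = l \<and> distinct c \<and>
     (\<forall>j<l. {c ! j, c ! ((j + 1) mod l)} \<in> E)"

definition has_disjoint_cycles :: "nat set set \<Rightarrow> nat \<Rightarrow> nat \<Rightarrow> bool" where
  "has_disjoint_cycles E l k \<longleftrightarrow>
     (\<exists>f :: nat \<Rightarrow> nat list. (\<forall>i<k. is_cycle E l (f i)) \<and>
        (\<forall>i<k. \<forall>j<k. i \<noteq> j \<longrightarrow> set (f i) \<inter> set (f j) = {}))"

definition gnp_prob :: "nat \<Rightarrow> real \<Rightarrow> (nat set set \<Rightarrow> bool) \<Rightarrow> real" where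
  "gnp_prob n p Q = (\<Sum>H\<in>Pow (all_pairs n).
      (if Q H then p ^ card H * (1 - p) ^ (card (all_pairs n) - card H) else 0))"

end

theory Submission
  imports Defs
begin

text \<open>Write \<open>m\<close> for the number of cycles sought. A cycle with one vertex in \<open>A\<close> and
  \<open>l - 1\<close> in \<open>B\<close> is a path of random edges in \<open>B\<close> closed through \<open>A\<close> by edges of \<open>G\<close>. Inside \<open>B\<close>
  we fix in advance small disjoint reservoirs; since \<open>p \<ge> C ln n / n\<close>, every small vertex set expands
  into every reservoir, and any two disjoint sets of size \<open>e = \<lceil>\<eta> n\<rceil>\<close> are joined by a random edge. Hence any
  \<open>l - 1\<close> equally large parts of \<open>B\<close> that contain one reservoir each are linked by perfect matchings
  into disjoint paths, and Hall's condition matches these paths to the vertices of \<open>A\<close>; the few atypical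
  vertices of \<open>A\<close> are covered greedily beforehand, and those of \<open>B\<close> are put in the first part.

  If \<open>A\<close> is too large, we first remove some cycles with two vertices in \<open>A\<close> that are joined by a random edge.
  If \<open>A\<close> is too small, then \<open>G\<close> has minimum degree at least \<open>d = m - |A|\<close> inside \<open>B\<close>, and we need
  \<open>d\<close> cycles inside \<open>B\<close>. Vertices of linear degree in \<open>B\<close> are centres of cycles through their
  neighbourhoods. Without them at least a constant multiple of \<open>d n\<close> edges \<open>uv\<close> with small maximum degree
  remain. After all random edges except those at the vertices \<open>v\<close> have been exposed, order of \<open>d n\<close> pairs
  would close an edge \<open>uv\<close> to an \<open>l\<close>-cycle, even when any \<open>l d\<close> vertices are forbidden. All these pairs
  are missing with probability \<open>n\<close> to the power of minus a large multiple of \<open>d\<close>, which beats the number of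
  choices of the forbidden vertices.\<close>

section \<open>Random edge sets and union bounds\<close>

text \<open>The ground set \<open>X\<close> is arbitrary, so that pairs can be exposed one at a time
  by induction on \<open>X\<close>; \<open>gnp_prob\<close> is the case
  \<open>X = all_pairs n\<close>.\<close>

definition edge_prob :: "'a set \<Rightarrow> real \<Rightarrow> ('a set \<Rightarrow> bool) \<Rightarrow> real" where
  "edge_prob X p Q = (\<Sum>H\<in>Pow X. if Q H then p ^ card H * (1 - p) ^ (card X - card H) else 0)"

lemma gnp_prob_eq: "gnp_prob n p Q = edge_prob (all_pairs n) p Q"
  by (simp add: gnp_prob_def edge_prob_def)

lemma edge_prob_empty: "edge_prob {} p Q = (if Q {} then 1 else 0)"
  by (simp add: edge_prob_def)

lemma edge_prob_insert:
  assumes "finite X" "x \<notin> X"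
  shows "edge_prob (insert x X) p Q = p * edge_prob X p (\<lambda>H. Q (insert x H)) + (1 - p) * edge_prob X p Q"
proof -
  have disj: "Pow X \<inter> insert x ` Pow X = {}" using assms by auto
  have inj: "inj_on (insert x) (Pow X)"
    using assms(2) by (rule_tac inj_onI) (metis Pow_iff insert_ident subsetD)
  let ?w = "\<lambda>H. if Q H then p ^ card H * (1 - p) ^ (card (insert x X) - card H) else 0"
  have "edge_prob (insert x X) p Q = sum ?w (Pow X) + sum ?w (insert x ` Pow X)"
    unfolding edge_prob_def Pow_insert using assms disj by (intro sum.union_disjoint) auto
  moreover have "sum ?w (insert x ` Pow X) = p * edge_prob X p (\<lambda>H. Q (insert x H))"
    unfolding sum.reindex[OF inj] edge_prob_def sum_distrib_left o_def
  proof (rule sum.cong[OF refl])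
    fix H assume "H \<in> Pow X"
    then have "x \<notin> H" "finite H" using assms finite_subset by auto
    then show "(if Q (insert x H) then p ^ card (insert x H) * (1 - p) ^ (card (insert x X) - card (insert x H)) else 0)
       = p * (if Q (insert x H) then p ^ card H * (1 - p) ^ (card X - card H) else 0)"
      using assms by simp
  qed
  moreover have "sum ?w (Pow X) = (1 - p) * edge_prob X p Q"
    unfolding edge_prob_def sum_distrib_left
  proof (rule sum.cong[OF refl])
    fix H assume H: "H \<in> Pow X"
    then have "card H \<le> card X" using assms by (auto intro: card_mono)
    then have "card (insert x X) - card H = Suc (card X - card H)" using assms by simp
    then show "(if Q H then p ^ card H * (1 - p) ^ (card (insert x X) - card H) else 0)
       = (1 - p) * (if Q H then p ^ card H * (1 - p) ^ (card X - card H) else 0)"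
      by simp
  qed
  ultimately show ?thesis by simp
qed

lemma edge_prob_True: "finite X \<Longrightarrow> edge_prob X p (\<lambda>H. True) = 1"
proof (induction X rule: finite_induct)
  case empty
  then show ?case by (simp add: edge_prob_empty)
next
  case (insert x X)
  show ?case unfolding edge_prob_insert[OF insert.hyps] insert.IH by simp
qed

context
  fixes p :: real
  assumes p0: "0 \<le> p" and p1: "p \<le> 1"
begin

lemma edge_prob_mono:
  assumes "finite X" "\<And>H. H \<subseteq> X \<Longrightarrow> Q H \<Longrightarrow> R H"
  shows "edge_prob X p Q \<le> edge_prob X p R"
  unfolding edge_prob_def using assms p0 p1 by (intro sum_mono) auto

lemma edge_prob_Ex_le:
  assumes "finite X" "finite I"
  shows "edge_prob X p (\<lambda>H. \<exists>i\<in>I. Q i H) \<le> (\<Sum>i\<in>I. edge_prob X p (Q i))"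
proof -
  let ?w = "\<lambda>H. p ^ card H * (1 - p) ^ (card X - card H)"
  have w0: "?w H \<ge> 0" for H :: "'a set" using p0 p1 by simp
  have "edge_prob X p (\<lambda>H. \<exists>i\<in>I. Q i H) \<le> (\<Sum>H\<in>Pow X. \<Sum>i\<in>I. if Q i H then ?w H else 0)"
    unfolding edge_prob_def
  proof (rule sum_mono)
    fix H assume "H \<in> Pow X"
    show "(if \<exists>i\<in>I. Q i H then ?w H else 0) \<le> (\<Sum>i\<in>I. if Q i H then ?w H else 0)"
    proof (cases "\<exists>i\<in>I. Q i H")
      case True
      then obtain i where i: "i \<in> I" "Q i H" by blast
      have "(if Q i H then ?w H else 0) \<le> (\<Sum>i\<in>I. if Q i H then ?w H else 0)"
        using assms i w0 by (intro member_le_sum) auto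
      then show ?thesis using i True by auto
    qed (auto intro!: sum_nonneg w0)
  qed
  also have "\<dots> = (\<Sum>i\<in>I. edge_prob X p (Q i))"
    unfolding edge_prob_def by (rule sum.swap)
  finally show ?thesis .
qed

lemma edge_prob_disj_le:
  assumes "finite X"
  shows "edge_prob X p (\<lambda>H. Q H \<or> R H) \<le> edge_prob X p Q + edge_prob X p R"
  unfolding edge_prob_def sum.distrib[symmetric] using p0 p1 by (intro sum_mono) auto

lemma edge_prob_not:
  assumes "finite X"
  shows "edge_prob X p Q = 1 - edge_prob X p (\<lambda>H. \<not> Q H)"
proof -
  have "edge_prob X p Q + edge_prob X p (\<lambda>H. \<not> Q H) = edge_prob X p (\<lambda>H. True)"
    unfolding edge_prob_def sum.distrib[symmetric] by (intro sum.cong) auto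
  then show ?thesis using edge_prob_True[OF assms, of p] by simp
qed

lemma edge_prob_avoid:
  assumes "finite X" "M \<subseteq> X"
  shows "edge_prob X p (\<lambda>H. M \<inter> H = {}) = (1 - p) ^ card M"
  using assms
proof (induction X arbitrary: M rule: finite_induct)
  case empty
  then show ?case by (simp add: edge_prob_empty)
next
  case (insert x X)
  show ?case
  proof (cases "x \<in> M")
    case True
    then have z: "edge_prob X p (\<lambda>H. M \<inter> insert x H = {}) = 0"
      by (auto simp: edge_prob_def)
    have "edge_prob X p (\<lambda>H. M \<inter> H = {}) = edge_prob X p (\<lambda>H. (M - {x}) \<inter> H = {})"
      unfolding edge_prob_def using insert.hyps by (intro sum.cong) auto
    also have "\<dots> = (1 - p) ^ card (M - {x})" using insert by (intro insert.IH) auto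
    finally show ?thesis
      unfolding edge_prob_insert[OF insert.hyps] z
      using card_Suc_Diff1[of M x] True insert finite_subset[of M "insert x X"]
      by (metis add_0 finite_insert mult_zero_right power_Suc)
  next
    case False
    then have "edge_prob X p (\<lambda>H. M \<inter> insert x H = {}) = edge_prob X p (\<lambda>H. M \<inter> H = {})"
      by (auto simp: edge_prob_def)
    moreover have "edge_prob X p (\<lambda>H. M \<inter> H = {}) = (1 - p) ^ card M"
      using insert False by (intro insert.IH) auto
    ultimately show ?thesis
      unfolding edge_prob_insert[OF insert.hyps] by (simp add: algebra_simps)
  qed
qed

text \<open>Two-round exposure: the target set \<open>M (H \<inter> Y)\<close> is determined by the pairs in \<open>Y\<close>
  and lies in the pairs \<open>X\<close> that are exposed only afterwards.\<close>

lemma edge_prob_avoid_exposed: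
  assumes "finite Y" "finite X" "X \<inter> Y = {}" "\<And>H. M H \<subseteq> X"
  shows "edge_prob (Y \<union> X) p (\<lambda>H. s \<le> card (M (H \<inter> Y)) \<and> M (H \<inter> Y) \<inter> H = {}) \<le> (1 - p) ^ s"
  using assms
proof (induction Y arbitrary: M rule: finite_induct)
  case empty
  show ?case
  proof (cases "s \<le> card (M {})")
    case True
    then have "edge_prob X p (\<lambda>H. s \<le> card (M {}) \<and> M {} \<inter> H = {}) = (1 - p) ^ card (M {})"
      using edge_prob_avoid[of X "M {}"] empty by simp
    also have "\<dots> \<le> (1 - p) ^ s" using True p0 p1 by (intro power_decreasing) auto
    finally show ?thesis by simp
  qed (use p1 in \<open>auto simp: edge_prob_def\<close>)
next
  case (insert x Y)
  have x: "x \<notin> Y \<union> X" "finite (Y \<union> X)" using insert by auto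
  \<comment> \<open>The pair \<open>x\<close> lies in no target set. Exposing it only changes the
    target function, to \<open>\<lambda>H. M (insert x H)\<close> if \<open>x\<close> is present,
    and the induction hypothesis applies in both cases.\<close>
  have M: "M H \<inter> insert x H' = M H \<inter> H'" for H H' using insert.prems x by blast
  let ?P = "\<lambda>H. s \<le> card (M (H \<inter> insert x Y)) \<and> M (H \<inter> insert x Y) \<inter> H = {}"
  have "edge_prob (Y \<union> X) p (\<lambda>H. ?P (insert x H)) =
        edge_prob (Y \<union> X) p (\<lambda>H. s \<le> card (M (insert x (H \<inter> Y))) \<and> M (insert x (H \<inter> Y)) \<inter> H = {})"
    unfolding edge_prob_def
  proof (rule sum.cong[OF refl])
    fix H assume "H \<in> Pow (Y \<union> X)"
    have e: "insert x H \<inter> insert x Y = insert x (H \<inter> Y)" by blast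
    show "(if ?P (insert x H) then p ^ card H * (1 - p) ^ (card (Y \<union> X) - card H) else 0) =
      (if s \<le> card (M (insert x (H \<inter> Y))) \<and> M (insert x (H \<inter> Y)) \<inter> H = {}
       then p ^ card H * (1 - p) ^ (card (Y \<union> X) - card H) else 0)"
      unfolding e M ..
  qed
  also have "\<dots> \<le> (1 - p) ^ s"
    by (rule insert.IH[of "\<lambda>H. M (insert x H)"]) (use insert.prems in auto)
  finally have 1: "edge_prob (Y \<union> X) p (\<lambda>H. ?P (insert x H)) \<le> (1 - p) ^ s" .
  have "edge_prob (Y \<union> X) p ?P =
        edge_prob (Y \<union> X) p (\<lambda>H. s \<le> card (M (H \<inter> Y)) \<and> M (H \<inter> Y) \<inter> H = {})"
    unfolding edge_prob_def
  proof (rule sum.cong[OF refl])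
    fix H assume "H \<in> Pow (Y \<union> X)"
    then have "H \<inter> insert x Y = H \<inter> Y" using x by auto
    then show "(if ?P H then p ^ card H * (1 - p) ^ (card (Y \<union> X) - card H) else 0) =
      (if s \<le> card (M (H \<inter> Y)) \<and> M (H \<inter> Y) \<inter> H = {} then p ^ card H * (1 - p) ^ (card (Y \<union> X) - card H) else 0)"
      by simp
  qed
  also have "\<dots> \<le> (1 - p) ^ s" by (rule insert.IH) (use insert.prems in auto)
  finally have 2: "edge_prob (Y \<union> X) p ?P \<le> (1 - p) ^ s" .
  have "edge_prob (insert x Y \<union> X) p ?P \<le> p * (1 - p) ^ s + (1 - p) * (1 - p) ^ s"
    unfolding Un_insert_left edge_prob_insert[OF x(2,1)] 
    using 1 2 p0 p1 by (intro add_mono mult_left_mono) auto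
  then show ?case by (simp add: algebra_simps)
qed

lemma edge_prob_avoid_exposed_family:
  assumes "finite I" "finite Y" "finite X" "X \<inter> Y = {}" "\<And>i H. M i H \<subseteq> X"
  shows "edge_prob (Y \<union> X) p (\<lambda>H. \<exists>i\<in>I. s \<le> card (M i (H \<inter> Y)) \<and> M i (H \<inter> Y) \<inter> H = {})
    \<le> card I * (1 - p) ^ s"
proof -
  have "edge_prob (Y \<union> X) p (\<lambda>H. \<exists>i\<in>I. s \<le> card (M i (H \<inter> Y)) \<and> M i (H \<inter> Y) \<inter> H = {})
    \<le> (\<Sum>i\<in>I. edge_prob (Y \<union> X) p (\<lambda>H. s \<le> card (M i (H \<inter> Y)) \<and> M i (H \<inter> Y) \<inter> H = {}))"
    using assms by (intro edge_prob_Ex_le) auto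
  also have "\<dots> \<le> (\<Sum>i\<in>I. (1 - p) ^ s)"
    using assms by (intro sum_mono edge_prob_avoid_exposed) auto
  finally show ?thesis by simp
qed

end

text \<open>Such a set is the trace on \<open>{..<n}\<close> of a list of length \<open>z\<close>
  over \<open>{..n}\<close>, where the dummy entry \<open>n\<close> pads short lists.\<close>

lemma card_small_subsets_le:
  "card {Z. Z \<subseteq> {..<n} \<and> card Z \<le> z} \<le> (n + 1) ^ z"
proof -
  let ?L = "{xs. set xs \<subseteq> {..n} \<and> length xs = z}"
  have "{Z. Z \<subseteq> {..<n} \<and> card Z \<le> z} \<subseteq> (\<lambda>xs. set xs \<inter> {..<n}) ` ?L"
  proof safe
    fix Z assume Z: "Z \<subseteq> {..<n}" "card Z \<le> z"
    obtain ys where ys: "set ys = Z" "distinct ys"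
      using Z finite_distinct_list finite_subset by (metis finite_lessThan)
    let ?xs = "ys @ replicate (z - length ys) n"
    have "length ys = card Z" using ys distinct_card by metis
    then have "?xs \<in> ?L" using Z ys by (auto simp: less_imp_le)
    moreover have "Z = set ?xs \<inter> {..<n}" using Z ys by auto
    ultimately show "Z \<in> (\<lambda>xs. set xs \<inter> {..<n}) ` ?L" by blast
  qed
  moreover have "finite ?L" by (rule finite_lists_length_eq) auto
  ultimately have "card {Z. Z \<subseteq> {..<n} \<and> card Z \<le> z} \<le> card ?L" by (rule surj_card_le[rotated])
  also have "\<dots> = (n + 1) ^ z" by (subst card_lists_length_eq) auto
  finally show ?thesis .
qed

lemma finite_small_subsets: "finite {Z. Z \<subseteq> {..<n::nat} \<and> card Z \<le> z}"
  by (rule finite_subset[of _ "Pow {..<n}"]) auto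

text \<open>The inequality behind all union bounds: \<open>a\<close> is the number of vertices that determine
  a bad configuration and \<open>b\<close> the number of pairs that it forbids.\<close>

lemma union_bound_power:
  fixes n a b :: nat and p C :: real
  assumes "n \<ge> 2" "p \<le> 1" "C * ln n / n \<le> p" "C > 0" "real (2 * a + 2) * n \<le> C * b"
  shows "real (n + 1) ^ a * (1 - p) ^ b \<le> 1 / real n ^ 2"
proof -
  have n: "real n > 1" "ln (real n) > 0" using assms by auto
  \<comment> \<open>With this, the number of choices is at most \<open>exp (2 * a * ln n)\<close>;
    the \<open>+ 2\<close> in the hypothesis is what survives as \<open>1 / n^2\<close>.\<close>
  have "real (n + 1) \<le> real n ^ 2"
  proof -
    have "2 * real n \<le> real n * real n" using assms(1) by (intro mult_right_mono) auto
    moreover have "real n + 1 \<le> 2 * real n" using n by simp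
    moreover have "real (n + 1) = real n + 1" by simp
    ultimately show ?thesis unfolding power2_eq_square by linarith
  qed
  then have "real (n + 1) ^ a \<le> (real n ^ 2) ^ a" by (intro power_mono) auto
  also have "\<dots> = exp (real (2 * a) * ln n)"
  proof -
    have "exp (real (2 * a) * ln n) = exp (ln n) ^ (2 * a)" by (simp only: exp_of_nat_mult)
    then show ?thesis using n by (simp add: power_mult)
  qed
  finally have 1: "real (n + 1) ^ a \<le> exp (real (2 * a) * ln n)" .
  have "1 - p \<le> exp (- p)" using exp_ge_add_one_self[of "- p"] by simp
  then have "(1 - p) ^ b \<le> exp (- p) ^ b" using assms by (intro power_mono) auto
  also have "\<dots> = exp (real b * - p)" by (simp only: exp_of_nat_mult)
  also have "\<dots> \<le> exp (- (real (2 * a + 2) * ln n))"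
  proof -
    have "real (2 * a + 2) * ln n = (real (2 * a + 2) * n) * (ln n / n)" using n by simp
    also have "\<dots> \<le> (C * b) * (ln n / n)" using assms n by (intro mult_right_mono) auto
    also have "\<dots> = real b * (C * ln n / n)" by simp
    also have "\<dots> \<le> real b * p" using assms by (intro mult_left_mono) auto
    finally show ?thesis by simp
  qed
  finally have 2: "(1 - p) ^ b \<le> exp (- (real (2 * a + 2) * ln n))" .
  have "real (n + 1) ^ a * (1 - p) ^ b \<le> exp (real (2 * a) * ln n) * exp (- (real (2 * a + 2) * ln n))"
    using 1 2 assms by (intro mult_mono) auto
  also have "\<dots> = exp (real 2 * - ln n)" by (simp add: exp_add[symmetric] algebra_simps)
  also have "\<dots> = exp (- ln n) ^ 2" by (simp only: exp_of_nat_mult)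
  also have "\<dots> = 1 / real n ^ 2" using n by (simp add: exp_minus power_divide inverse_eq_divide)
  finally show ?thesis .
qed

section \<open>Packings of cycles, matchings and cuts\<close>

text \<open>Hall's theorem, by induction on \<open>card I\<close>. If a nonempty proper
  \<open>J\<close> is tight, match \<open>J\<close> first and then its complement outside the
  neighbourhood of \<open>J\<close>; otherwise every such \<open>J\<close> has a neighbour to spare,
  and a single match may be fixed arbitrarily.\<close>

lemma marriage:
  assumes "finite I" "\<And>i. i \<in> I \<Longrightarrow> finite (N i)"
    and "\<And>J. J \<subseteq> I \<Longrightarrow> card J \<le> card (\<Union>i\<in>J. N i)"
  shows "\<exists>f. inj_on f I \<and> (\<forall>i\<in>I. f i \<in> N i)"
  using assms
proof (induction "card I" arbitrary: I N rule: less_induct)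
  case less
  note fin = less.prems(1) and finN = less.prems(2) and hall = less.prems(3)
  show ?case
  proof (cases "I = {}")
    case False
    then obtain i where i: "i \<in> I" by blast
    show ?thesis
    proof (cases "\<exists>J. J \<noteq> {} \<and> J \<subset> I \<and> card (\<Union>i\<in>J. N i) = card J")
      case True
      then obtain J where J: "J \<noteq> {}" "J \<subset> I" "card (\<Union>i\<in>J. N i) = card J" by blast
      have finJ: "finite J" using J fin finite_subset by blast
      have cJ: "card J < card I" using J fin by (simp add: psubset_card_mono)
      have cIJ: "card (I - J) < card I"
        using J fin by (intro psubset_card_mono) auto
      have "\<exists>f. inj_on f J \<and> (\<forall>i\<in>J. f i \<in> N i)"
        using J finJ finN hall by (intro less.hyps[OF cJ]) (auto simp: subset_iff)
      then obtain f where f: "inj_on f J" "\<forall>i\<in>J. f i \<in> N i" by blast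
      let ?NJ = "\<Union>i\<in>J. N i"
      have finNJ: "finite ?NJ" using finJ finN J by auto
      have "\<exists>g. inj_on g (I - J) \<and> (\<forall>i\<in>I - J. g i \<in> N i - ?NJ)"
      proof (rule less.hyps[OF cIJ])
        fix K assume K: "K \<subseteq> I - J"
        have finK: "finite K" using K fin finite_subset by blast
        have finNK: "finite (\<Union>i\<in>K. N i - ?NJ)" using finK finN K by auto
        \<comment> \<open>Hall's condition for \<open>J \<union> K\<close> minus the tight equality
          for \<open>J\<close> is Hall's condition for \<open>K\<close> in the reduced
          system.\<close>
        have "card J + card K = card (J \<union> K)"
          using K finJ finK by (subst card_Un_disjoint) auto
        also have "\<dots> \<le> card (\<Union>i\<in>J \<union> K. N i)" using J K by (intro hall) auto
        also have "(\<Union>i\<in>J \<union> K. N i) = ?NJ \<union> (\<Union>i\<in>K. N i - ?NJ)" by auto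
        also have "card \<dots> \<le> card ?NJ + card (\<Union>i\<in>K. N i - ?NJ)" by (rule card_Un_le)
        finally show "card K \<le> card (\<Union>i\<in>K. N i - ?NJ)" using J by simp
      qed (use fin finN in auto)
      then obtain g where g: "inj_on g (I - J)" "\<forall>i\<in>I - J. g i \<in> N i - ?NJ" by blast
      let ?h = "\<lambda>i. if i \<in> J then f i else g i"
      have "inj_on ?h I"
      proof (rule inj_onI)
        fix a b assume ab: "a \<in> I" "b \<in> I" "?h a = ?h b"
        have f': "f c \<in> ?NJ" if "c \<in> J" for c using f(2) that by blast
        have g': "g c \<notin> ?NJ" if "c \<in> I - J" for c using g(2) that by blast
        show "a = b"
        proof (cases "a \<in> J"; cases "b \<in> J")
          assume "a \<in> J" "b \<in> J"
          then show ?thesis using ab f(1) by (auto dest: inj_onD)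
        next
          assume "a \<in> J" "b \<notin> J"
          then show ?thesis using ab f'[of a] g'[of b] by auto
        next
          assume "a \<notin> J" "b \<in> J"
          then show ?thesis using ab f'[of b] g'[of a] by auto
        next
          assume "a \<notin> J" "b \<notin> J"
          then show ?thesis using ab g(1) by (auto dest: inj_onD)
        qed
      qed
      moreover have "\<forall>i\<in>I. ?h i \<in> N i" using f g by auto
      ultimately show ?thesis by blast
    next
      case noJ: False
      have "card {i} \<le> card (\<Union>j\<in>{i}. N j)" using i by (intro hall) auto
      then have "N i \<noteq> {}" by auto
      then obtain y where y: "y \<in> N i" by blast
      have cI: "card (I - {i}) < card I" using i fin by (intro psubset_card_mono) auto
      have "\<exists>g. inj_on g (I - {i}) \<and> (\<forall>j\<in>I - {i}. g j \<in> N j - {y})"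
      proof (rule less.hyps[OF cI])
        fix K assume K: "K \<subseteq> I - {i}"
        show "card K \<le> card (\<Union>j\<in>K. N j - {y})"
        proof (cases "K = {}")
          case False
          have "K \<subset> I" using K i by auto
          then have "card (\<Union>j\<in>K. N j) \<noteq> card K" using noJ False by blast
          moreover have "card K \<le> card (\<Union>j\<in>K. N j)" using K by (intro hall) auto
          moreover have "(\<Union>j\<in>K. N j - {y}) = (\<Union>j\<in>K. N j) - {y}" by auto
          moreover have "card (\<Union>j\<in>K. N j) \<le> Suc (card ((\<Union>j\<in>K. N j) - {y}))"
            by (simp add: card_Diff_singleton_if) linarith
          ultimately show ?thesis by simp
        qed simp
      qed (use fin finN in auto)
      then obtain g where g: "inj_on g (I - {i})" "\<forall>j\<in>I - {i}. g j \<in> N j - {y}" by blast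
      let ?h = "g(i := y)"
      have "inj_on ?h I" using g by (auto simp: inj_on_def)
      moreover have "\<forall>j\<in>I. ?h j \<in> N j" using g y by auto
      ultimately show ?thesis by blast
    qed
  qed auto
qed

section \<open>Cycles as vertex lists, and packings of disjoint cycles\<close>

lemma is_cycleI:
  assumes "length c = l" "distinct c" "c \<noteq> []" "successively (\<lambda>x y. {x, y} \<in> E) c" "{last c, hd c} \<in> E"
  shows "is_cycle E l c"
proof -
  have "{c ! j, c ! ((j + 1) mod l)} \<in> E" if "j < l" for j
  proof (cases "Suc j = l")
    case True
    then show ?thesis using assms by (metis One_nat_def add.right_neutral add_Suc_right diff_Suc_1 hd_conv_nth last_conv_nth mod_self)
  next
    case False
    then show ?thesis using assms that by (auto simp: successively_conv_nth)
  qed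
  then show ?thesis using assms by (simp add: is_cycle_def)
qed

text \<open>\<open>U\<close> is exactly the set of vertices used, so that packings can be glued when
  these sets are disjoint, and their size is known by \<open>packs_card\<close>.\<close>

definition packs :: "nat set set \<Rightarrow> nat \<Rightarrow> nat \<Rightarrow> nat set \<Rightarrow> bool" where
  "packs E l k U \<longleftrightarrow> (\<exists>f. (\<forall>i<k. is_cycle E l (f i)) \<and>
     (\<forall>i<k. \<forall>j<k. i \<noteq> j \<longrightarrow> set (f i) \<inter> set (f j) = {}) \<and> (\<Union>i<k. set (f i)) = U)"

lemma packs_imp_has_disjoint_cycles: "packs E l k U \<Longrightarrow> has_disjoint_cycles E l k"
  by (auto simp: packs_def has_disjoint_cycles_def)

lemma packs_0: "packs E l 0 {}"
  by (simp add: packs_def)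

lemma packs_1: "is_cycle E l c \<Longrightarrow> packs E l 1 (set c)"
  unfolding packs_def by (rule exI[of _ "\<lambda>_. c"]) auto

lemma packs_add:
  assumes "packs E l k U" "packs E l k' U'" "U \<inter> U' = {}"
  shows "packs E l (k + k') (U \<union> U')"
proof -
  obtain f where f: "\<forall>i<k. is_cycle E l (f i)" "\<forall>i<k. \<forall>j<k. i \<noteq> j \<longrightarrow> set (f i) \<inter> set (f j) = {}"
    "(\<Union>i<k. set (f i)) = U" using assms(1) by (auto simp: packs_def)
  obtain g where g: "\<forall>i<k'. is_cycle E l (g i)" "\<forall>i<k'. \<forall>j<k'. i \<noteq> j \<longrightarrow> set (g i) \<inter> set (g j) = {}"
    "(\<Union>i<k'. set (g i)) = U'" using assms(2) by (auto simp: packs_def)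
  define h where "h i = (if i < k then f i else g (i - k))" for i
  have h1: "\<forall>i<k+k'. is_cycle E l (h i)" using f g by (auto simp: h_def)
  have fU: "set (f i) \<subseteq> U" if "i < k" for i using that f by auto
  have gU: "set (g i) \<subseteq> U'" if "i < k'" for i using that g by auto
  have h2: "set (h i) \<inter> set (h j) = {}" if "i < k + k'" "j < k + k'" "i \<noteq> j" for i j
  proof -
    consider "i < k" "j < k" | "i < k" "k \<le> j" | "k \<le> i" "j < k" | "k \<le> i" "k \<le> j" by linarith
    then show ?thesis
    proof cases
      case 1 then show ?thesis using f that by (simp add: h_def)
    next
      case 2
      then have "set (f i) \<subseteq> U" "set (g (j - k)) \<subseteq> U'" using that by (intro fU gU; linarith)+
      then show ?thesis using assms(3) 2 unfolding h_def by auto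
    next
      case 3
      then have "set (f j) \<subseteq> U" "set (g (i - k)) \<subseteq> U'" using that by (intro fU gU; linarith)+
      then show ?thesis using assms(3) 3 unfolding h_def by auto
    next
      case 4
      then have "i - k < k'" "j - k < k'" "i - k \<noteq> j - k" using that by auto
      then show ?thesis using g 4 by (simp add: h_def)
    qed
  qed
  have "{..<k + k'} = {..<k} \<union> (\<lambda>i. k + i) ` {..<k'}"
    unfolding lessThan_atLeast0 image_add_atLeastLessThan by auto
  then have "(\<Union>i<k+k'. set (h i)) = U \<union> U'"
    unfolding f(3)[symmetric] g(3)[symmetric] by (simp add: h_def image_Un)
  then show ?thesis using h1 h2 unfolding packs_def by blast
qed

lemma packs_card:
  assumes "packs E l k U"
  shows "finite U" "card U = l * k"
proof -
  obtain f where f: "\<forall>i<k. is_cycle E l (f i)" "\<forall>i<k. \<forall>j<k. i \<noteq> j \<longrightarrow> set (f i) \<inter> set (f j) = {}"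
    "(\<Union>i<k. set (f i)) = U" using assms by (auto simp: packs_def)
  show "finite U" using f(3) by auto
  have "card U = (\<Sum>i<k. card (set (f i)))"
    unfolding f(3)[symmetric] using f by (intro card_UN_disjoint) auto
  also have "\<dots> = (\<Sum>i<k. l)"
    using f by (intro sum.cong) (auto simp: is_cycle_def distinct_card)
  finally show "card U = l * k" by simp
qed

lemma packs_Suc:
  assumes "packs E l k U" "is_cycle E l c" "set c \<inter> U = {}"
  shows "packs E l (Suc k) (U \<union> set c)"
  using packs_add[OF assms(1) packs_1[OF assms(2)]] assms(3) by auto

section \<open>Absence of bipartite holes of order \<open>e\<close> (\<open>joined\<close>),
  expansion into reservoirs, and random paths\<close>

definition joined :: "nat \<Rightarrow> nat set set \<Rightarrow> nat \<Rightarrow> bool" where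
  "joined n H e \<longleftrightarrow> (\<forall>X Y. X \<subseteq> {..<n} \<and> Y \<subseteq> {..<n} \<and> X \<inter> Y = {} \<and> e \<le> card X \<and> e \<le> card Y
     \<longrightarrow> (\<exists>x\<in>X. \<exists>y\<in>Y. {x, y} \<in> H))"

text \<open>\<open>Q\<close> is a reservoir fixed in advance. Sets \<open>S\<close> meeting
  \<open>Q\<close> are excluded, so that \<open>card_cross\<close> counts the pairs between
  \<open>S\<close> and a part of \<open>Q\<close>.\<close>

definition expands :: "nat \<Rightarrow> nat set set \<Rightarrow> nat set \<Rightarrow> nat \<Rightarrow> nat \<Rightarrow> bool" where
  "expands n H Q e K \<longleftrightarrow> (\<forall>S. S \<subseteq> {..<n} - Q \<and> card S \<le> e
     \<longrightarrow> K * card S \<le> card {y\<in>Q. \<exists>x\<in>S. {x, y} \<in> H})"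

lemma joinedD:
  assumes "joined n H e" "X \<subseteq> {..<n}" "Y \<subseteq> {..<n}" "X \<inter> Y = {}" "e \<le> card X" "e \<le> card Y"
  obtains x y where "x \<in> X" "y \<in> Y" "{x, y} \<in> H"
proof -
  have "\<exists>x\<in>X. \<exists>y\<in>Y. {x, y} \<in> H"
    using assms(1)[unfolded joined_def, rule_format, of X Y] assms(2-6) by simp
  then show ?thesis using that by auto
qed

lemma expandsD:
  assumes "expands n H Q e K" "S \<subseteq> {..<n}" "S \<inter> Q = {}" "card S \<le> e"
  shows "K * card S \<le> card {y\<in>Q. \<exists>x\<in>S. {x, y} \<in> H}"
proof -
  have "S \<subseteq> {..<n} - Q \<and> card S \<le> e" using assms(2-4) by auto
  then show ?thesis using assms(1) unfolding expands_def by simp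
qed

abbreviation walk :: "nat set set \<Rightarrow> nat list \<Rightarrow> bool" where
  "walk H \<equiv> successively (\<lambda>x y. {x, y} \<in> H)"

text \<open>A single growing path may get stuck, so the induction carries \<open>e\<close> possible
  ends: among at least \<open>2 * e\<close> fresh vertices, all but fewer than \<open>e\<close> are
  adjacent to one of these ends.\<close>

lemma joined_path_ends:
  assumes "joined n H e" "1 \<le> e" "Y \<subseteq> {..<n}" "2 * (k + 1) * e \<le> card Y"
  shows "e \<le> card {y\<in>Y. \<exists>xs. length xs = Suc k \<and> distinct xs \<and> set xs \<subseteq> Y \<and> last xs = y \<and> walk H xs}"
  using assms(3,4)
proof (induction k arbitrary: Y)
  case 0
  have "Y = {y\<in>Y. \<exists>xs. length xs = Suc 0 \<and> distinct xs \<and> set xs \<subseteq> Y \<and> last xs = y \<and> walk H xs}"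
  proof safe
    fix y assume "y \<in> Y"
    then show "\<exists>xs. length xs = Suc 0 \<and> distinct xs \<and> set xs \<subseteq> Y \<and> last xs = y \<and> walk H xs"
      by (intro exI[of _ "[y]"]) auto
  qed
  then show ?case using 0 by simp
next
  case (Suc k)
  have finY: "finite Y" using Suc.prems finite_subset by blast
  have "2 * (k + 1) * e \<le> card Y" using Suc.prems by (simp add: algebra_simps)
  then obtain Y1 where Y1: "Y1 \<subseteq> Y" "card Y1 = 2 * (k + 1) * e" "finite Y1"
    using obtain_subset_with_card_n by metis
  let ?P = "\<lambda>Y k y. \<exists>xs. length xs = Suc k \<and> distinct xs \<and> set xs \<subseteq> Y \<and> last xs = y \<and> walk H xs"
  let ?E = "{y\<in>Y1. ?P Y1 k y}"
  have E: "e \<le> card ?E" using Suc.prems Y1 by (intro Suc.IH) auto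
  let ?F = "{y\<in>Y - Y1. \<exists>x\<in>?E. {x, y} \<in> H}"
  have "card (Y - Y1 - ?F) < e"
  proof (rule ccontr)
    assume "\<not> ?thesis"
    moreover have "?E \<subseteq> {..<n}" "Y - Y1 - ?F \<subseteq> {..<n}" "?E \<inter> (Y - Y1 - ?F) = {}"
      using Suc.prems(1) Y1(1) by auto
    ultimately obtain x y where "x \<in> ?E" "y \<in> Y - Y1 - ?F" "{x, y} \<in> H"
      using joinedD[OF assms(1), of ?E "Y - Y1 - ?F"] E by (metis (lifting) not_less)
    then show False by blast
  qed
  moreover have "card (Y - Y1) = card Y - card Y1" using Y1 by (intro card_Diff_subset) auto
  moreover have "card (Y - Y1) \<le> card ?F + card (Y - Y1 - ?F)"
  proof -
    have "Y - Y1 = ?F \<union> (Y - Y1 - ?F)" by blast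
    then show ?thesis using card_Un_le[of ?F "Y - Y1 - ?F"] by argo
  qed
  moreover have "2 * (Suc k + 1) * e = 2 * (k + 1) * e + 2 * e" by (simp add: algebra_simps)
  ultimately have "e \<le> card ?F" using Suc.prems Y1 by linarith
  also have "card ?F \<le> card {y\<in>Y. ?P Y (Suc k) y}"
  proof (intro card_mono)
    show "?F \<subseteq> {y\<in>Y. ?P Y (Suc k) y}"
    proof safe
      fix y x xs assume h: "y \<in> Y" "y \<notin> Y1" "last xs \<in> Y1" "{last xs, y} \<in> H" "length xs = Suc k"
        "distinct xs" "set xs \<subseteq> Y1" "walk H xs"
      then have "walk H (xs @ [y])" by (auto simp: successively_append_iff)
      then show "?P Y (Suc k) y" using h Y1 by (intro exI[of _ "xs @ [y]"]) auto
    qed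
  qed (use finY in auto)
  finally show ?case .
qed

lemma joined_path:
  assumes "joined n H e" "1 \<le> e" "Y \<subseteq> {..<n}" "2 * k * e \<le> card Y" "1 \<le> k"
  obtains xs where "length xs = k" "distinct xs" "set xs \<subseteq> Y" "walk H xs"
proof -
  have k: "Suc (k - 1) = k" using assms by simp
  have "e \<le> card {y\<in>Y. \<exists>xs. length xs = k \<and> distinct xs \<and> set xs \<subseteq> Y \<and> last xs = y \<and> walk H xs}"
    using joined_path_ends[OF assms(1-3), of "k - 1"] assms(4,5) unfolding k by simp
  then have "{y\<in>Y. \<exists>xs. length xs = k \<and> distinct xs \<and> set xs \<subseteq> Y \<and> last xs = y \<and> walk H xs} \<noteq> {}"
    using assms(2) by (metis card.empty not_one_le_zero order_trans)
  then show ?thesis using that by blast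
qed

lemma nbhd_sym: "u \<in> nbhd E v \<longleftrightarrow> v \<in> nbhd E u"
  by (simp add: nbhd_def insert_commute)

lemma pack_stars:
  assumes "joined n H e" "1 \<le> e" "3 \<le> l" "finite X" "Y \<subseteq> {..<n}" "X \<inter> Y = {}"
    and "\<And>x. x \<in> X \<Longrightarrow> (l - 1) * card X + 2 * (l - 1) * e \<le> card (nbhd G x \<inter> Y)"
  shows "\<exists>U. packs (G \<union> H) l (card X) U \<and> X \<subseteq> U \<and> U \<subseteq> X \<union> Y"
proof -
  have finY: "finite Y" using assms finite_subset by blast
  have "\<exists>U. packs (G \<union> H) l (card Z) U \<and> Z \<subseteq> U \<and> U \<subseteq> Z \<union> Y" if "Z \<subseteq> X" for Z
    using finite_subset[OF that assms(4)] that
  proof (induction Z rule: finite_induct)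
    case empty
    then show ?case using packs_0 by force
  next
    case (insert x Z)
    then obtain U where U: "packs (G \<union> H) l (card Z) U" "Z \<subseteq> U" "U \<subseteq> Z \<union> Y" by auto
    have finU: "finite U" "card U = l * card Z" using packs_card[OF U(1)] by auto
    \<comment> \<open>The centres lie outside \<open>Y\<close>, so each finished cycle uses up only
      \<open>l - 1\<close> vertices of \<open>Y\<close>.\<close>
    have "card (U \<inter> Y) + card Z \<le> card U"
    proof -
      have "card (U \<inter> Y) + card Z = card ((U \<inter> Y) \<union> Z)"
        using finU insert assms(6) by (subst card_Un_disjoint) auto
      also have "\<dots> \<le> card U" using U finU by (intro card_mono) auto
      finally show ?thesis .
    qed
    then have "card (U \<inter> Y) \<le> (l - 1) * card Z" using finU by (simp add: diff_mult_distrib)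
    also have "\<dots> \<le> (l - 1) * card X"
      using insert.prems insert.hyps assms(4) by (intro mult_left_mono card_mono) auto
    finally have c: "card (U \<inter> Y) \<le> (l - 1) * card X" .
    have "card (nbhd G x \<inter> Y) \<le> card ((nbhd G x \<inter> Y) - U) + card (U \<inter> Y)"
    proof -
      have "card (nbhd G x \<inter> Y) \<le> card (((nbhd G x \<inter> Y) - U) \<union> (U \<inter> Y))"
        using finY by (intro card_mono) auto
      then show ?thesis using card_Un_le order_trans by blast
    qed
    moreover have "(l - 1) * card X + 2 * (l - 1) * e \<le> card (nbhd G x \<inter> Y)" using insert.prems assms(7) by auto
    ultimately have "2 * (l - 1) * e \<le> card ((nbhd G x \<inter> Y) - U)" using c by linarith
    moreover have "(nbhd G x \<inter> Y) - U \<subseteq> {..<n}" "1 \<le> l - 1" using assms(3,5) by auto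
    ultimately obtain xs where xs: "length xs = l - 1" "distinct xs" "set xs \<subseteq> (nbhd G x \<inter> Y) - U" "walk H xs"
      using joined_path[OF assms(1,2)] by metis
    have ne: "xs \<noteq> []" using xs assms(3) by auto
    have xX: "x \<notin> Y" "x \<in> X" using insert.prems assms(6) by auto
    have cyc: "is_cycle (G \<union> H) l (x # xs)"
    proof (rule is_cycleI)
      have "hd xs \<in> nbhd G x" "last xs \<in> nbhd G x" using xs(3) ne hd_in_set last_in_set by blast+
      then have "{x, hd xs} \<in> G" "{last xs, x} \<in> G" by (auto simp: nbhd_def insert_commute)
      moreover have "walk (G \<union> H) xs" using xs(4) by (rule successively_mono) auto
      ultimately show "walk (G \<union> H) (x # xs)" "{last (x # xs), hd (x # xs)} \<in> G \<union> H"
        using ne by (auto simp: successively_Cons)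
    qed (use xs xX assms(3) in auto)
    have "set (x # xs) \<inter> U = {}" using xs U xX insert by auto
    from packs_Suc[OF U(1) cyc this] show ?case
      using insert xs U by (intro exI[of _ "U \<union> set (x # xs)"]) auto
  qed
  then show ?thesis by blast
qed

text \<open>Hall's condition for \<open>S\<close>. A set of at most \<open>e\<close> vertices
  expands into \<open>Q'\<close>. For a larger \<open>S\<close>, fewer than \<open>e\<close>
  vertices of \<open>W'\<close> have no neighbour in \<open>S\<close>; these expand into
  \<open>Q\<close>, and their neighbours there lie in \<open>W - S\<close>, so they number at most
  \<open>card (W - S)\<close>.\<close>

lemma expander_matching:
  assumes "joined n H e" "1 \<le> e" "W \<subseteq> {..<n}" "W' \<subseteq> {..<n}" "W \<inter> W' = {}" "card W = card W'"
    and "expands n H Q e K" "Q \<subseteq> W" "expands n H Q' e K" "Q' \<subseteq> W'" "1 \<le> K"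
  shows "\<exists>f. bij_betw f W W' \<and> (\<forall>x\<in>W. {x, f x} \<in> H)"
proof -
  have fin: "finite W" "finite W'" using assms finite_subset by blast+
  let ?N = "\<lambda>x. {y\<in>W'. {x, y} \<in> H}"
  have "card S \<le> card (\<Union>x\<in>S. ?N x)" if S: "S \<subseteq> W" for S
  proof (cases "card S \<le> e")
    case True
    have "K * card S \<le> card {y\<in>Q'. \<exists>x\<in>S. {x, y} \<in> H}"
      using S assms(3,5,10) by (intro expandsD[OF assms(9) _ _ True]) auto
    also have "\<dots> \<le> card (\<Union>x\<in>S. ?N x)"
      using assms(10) fin finite_subset[OF S] by (intro card_mono) auto
    finally show ?thesis using mult_le_mono1[OF assms(11), of "card S"] by linarith
  next
    case False
    let ?NS = "\<Union>x\<in>S. ?N x" and ?T = "W' - (\<Union>x\<in>S. ?N x)"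
    have "card ?T < e"
    proof (rule ccontr)
      assume "\<not> card ?T < e"
      moreover have "S \<subseteq> {..<n}" "?T \<subseteq> {..<n}" "S \<inter> ?T = {}" using S assms(3-5) by auto
      ultimately obtain x y where "x \<in> S" "y \<in> ?T" "{x, y} \<in> H"
        using joinedD[OF assms(1), of S ?T] False by (metis (lifting) not_less linear)
      then show False by blast
    qed
    then have "K * card ?T \<le> card {y\<in>Q. \<exists>x\<in>?T. {x, y} \<in> H}"
      using assms(4,5,8) by (intro expandsD[OF assms(7)]) auto
    also have "\<dots> \<le> card (W - S)"
    proof (rule card_mono)
      show "{y\<in>Q. \<exists>x\<in>?T. {x, y} \<in> H} \<subseteq> W - S" using assms(8) by (auto simp: insert_commute)
    qed (use fin in auto)
    finally have "card ?T \<le> card (W - S)" using mult_le_mono1[OF assms(11), of "card ?T"] by linarith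
    moreover have "card (W - S) = card W - card S" using S fin finite_subset by (intro card_Diff_subset) auto
    moreover have "card S \<le> card W" using S fin by (intro card_mono) auto
    moreover have "card ?T = card W' - card ?NS" using fin finite_subset[OF S] by (intro card_Diff_subset) auto
    moreover have "card ?NS \<le> card W'" using fin by (intro card_mono) auto
    ultimately show ?thesis using assms(6) by linarith
  qed
  then obtain f where f: "inj_on f W" "\<forall>x\<in>W. f x \<in> ?N x"
    using marriage[of W ?N] fin by auto
  have "f ` W = W'"
    using f fin assms(6) by (intro card_subset_eq) (auto simp: card_image)
  then show ?thesis using f by (auto simp: bij_betw_def)
qed

text \<open>The matchings are composed, so that \<open>g i j\<close> is the vertex at which the
  \<open>j\<close>-th of \<open>k\<close> disjoint paths meets \<open>W i\<close>.\<close>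

lemma expander_matching_chain:
  assumes "joined n H e" "1 \<le> e" "1 \<le> K"
    and "\<And>i. i \<le> q \<Longrightarrow> W i \<subseteq> {..<n} \<and> card (W i) = k \<and> Q i \<subseteq> W i \<and> expands n H (Q i) e K"
    and "\<And>i j. i \<le> q \<Longrightarrow> j \<le> q \<Longrightarrow> i \<noteq> j \<Longrightarrow> W i \<inter> W j = {}"
  shows "\<exists>g. (\<forall>i\<le>q. bij_betw (g i) {..<k} (W i)) \<and> (\<forall>i<q. \<forall>j<k. {g i j, g (Suc i) j} \<in> H)"
  using assms(4,5)
proof (induction q)
  case 0
  have "finite (W 0)" "card (W 0) = k" using 0(1)[of 0] finite_subset by auto
  then obtain h where "bij_betw h {..<k} (W 0)"
    using ex_bij_betw_nat_finite[of "W 0"] by (auto simp: atLeast0LessThan)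
  then show ?case by (intro exI[of _ "\<lambda>_. h"]) auto
next
  case (Suc q)
  obtain g where g: "\<forall>i\<le>q. bij_betw (g i) {..<k} (W i)" "\<forall>i<q. \<forall>j<k. {g i j, g (Suc i) j} \<in> H"
    using Suc.IH Suc.prems by (metis le_SucI)
  have p: "W q \<subseteq> {..<n} \<and> card (W q) = k \<and> Q q \<subseteq> W q \<and> expands n H (Q q) e K"
    "W (Suc q) \<subseteq> {..<n} \<and> card (W (Suc q)) = k \<and> Q (Suc q) \<subseteq> W (Suc q) \<and> expands n H (Q (Suc q)) e K"
    "W q \<inter> W (Suc q) = {}"
    using Suc.prems(1)[of q] Suc.prems(1)[of "Suc q"] Suc.prems(2)[of q "Suc q"] by auto
  obtain f where f: "bij_betw f (W q) (W (Suc q))" "\<forall>x\<in>W q. {x, f x} \<in> H"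
    using expander_matching[OF assms(1,2), of "W q" "W (Suc q)" "Q q" K "Q (Suc q)"] p assms(3) by auto
  let ?g = "g(Suc q := f \<circ> g q)"
  have gq: "bij_betw (g q) {..<k} (W q)" using g by auto
  have "bij_betw (?g i) {..<k} (W i)" if "i \<le> Suc q" for i
    using that g(1) bij_betw_trans[OF gq f(1)] by (auto simp: le_Suc_eq)
  moreover have "{?g i j, ?g (Suc i) j} \<in> H" if "i < Suc q" "j < k" for i j
    using that g(2) f(2) bij_betwE[OF gq] by (auto simp: less_Suc_eq)
  ultimately show ?case by blast
qed

text \<open>The seeds \<open>S i\<close> are filled up one after another. All other parts have at
  most \<open>k\<close> vertices each, so \<open>q * k \<le> card B\<close> leaves enough free
  vertices for the current one.\<close>

lemma extend_to_equal_parts: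
  assumes "finite B" "q * k \<le> card B" "\<And>i. i < q \<Longrightarrow> S i \<subseteq> B \<and> card (S i) \<le> k"
    and "\<And>i j. i < q \<Longrightarrow> j < q \<Longrightarrow> i \<noteq> j \<Longrightarrow> S i \<inter> S j = {}"
  shows "\<exists>W. (\<forall>i<q. S i \<subseteq> W i \<and> W i \<subseteq> B \<and> card (W i) = k) \<and> (\<forall>i<q. \<forall>j<q. i \<noteq> j \<longrightarrow> W i \<inter> W j = {})"
proof -
  have "\<exists>W. (\<forall>i<q. S i \<subseteq> W i \<and> W i \<subseteq> B \<and> card (W i) \<le> k \<and> (i < j \<longrightarrow> card (W i) = k))
     \<and> (\<forall>i<q. \<forall>j<q. i \<noteq> j \<longrightarrow> W i \<inter> W j = {})" if "j \<le> q" for j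
    using that
  proof (induction j)
    case 0
    then show ?case using assms(3,4) by (intro exI[of _ S]) auto
  next
    case (Suc j)
    then obtain W where W: "\<forall>i<q. S i \<subseteq> W i \<and> W i \<subseteq> B \<and> card (W i) \<le> k \<and> (i < j \<longrightarrow> card (W i) = k)"
      "\<forall>i<q. \<forall>j<q. i \<noteq> j \<longrightarrow> W i \<inter> W j = {}" by auto
    have j: "j < q" using Suc by simp
    let ?F = "B - (\<Union>i<q. W i)"
    have finW: "finite (W i)" if "i < q" for i using finite_subset[OF _ assms(1)] W(1) that by simp
    have "card (\<Union>i<q. W i) = (\<Sum>i<q. card (W i))"
      using W finW by (intro card_UN_disjoint) auto
    also have "\<dots> = card (W j) + (\<Sum>i\<in>{..<q} - {j}. card (W i))" using j by (intro sum.remove) auto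
    also have "(\<Sum>i\<in>{..<q} - {j}. card (W i)) \<le> (\<Sum>i\<in>{..<q} - {j}. k)" using W by (intro sum_mono) auto
    also have "\<dots> = (q - 1) * k" using j by simp
    finally have "card (\<Union>i<q. W i) \<le> card (W j) + (q - 1) * k" by simp
    moreover have "card ?F = card B - card (\<Union>i<q. W i)"
      using W finW by (intro card_Diff_subset) auto
    moreover have "q * k = k + (q - 1) * k" using j by (cases q) auto
    ultimately have "k - card (W j) \<le> card ?F" using assms(2) by linarith
    then obtain T where T: "T \<subseteq> ?F" "card T = k - card (W j)" "finite T"
      using obtain_subset_with_card_n by metis
    have "card (W j \<union> T) = k"
      using T W j finW by (subst card_Un_disjoint) auto
    then have "(\<forall>i<q. S i \<subseteq> (W(j := W j \<union> T)) i \<and> (W(j := W j \<union> T)) i \<subseteq> B \<and> card ((W(j := W j \<union> T)) i) \<le> k \<and> (i < Suc j \<longrightarrow> card ((W(j := W j \<union> T)) i) = k))"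
      using W(1) T by (auto simp: less_Suc_eq)
    moreover have "(W(j := W j \<union> T)) i \<inter> (W(j := W j \<union> T)) i' = {}" if "i < q" "i' < q" "i \<noteq> i'" for i i'
      using W(2)[rule_format, OF that] T j that by auto
    ultimately show ?case by blast
  qed
  from this[of q] show ?thesis by blast
qed

text \<open>Starting from \<open>T = P\<close>, drop a heaviest element of \<open>T\<close> until
  \<open>t\<close> elements remain; the average of \<open>w\<close> over \<open>T\<close> never
  increases.\<close>

lemma light_subset:
  fixes w :: "'a \<Rightarrow> nat"
  assumes "finite P" "t \<le> card P"
  shows "\<exists>T\<subseteq>P. card T = t \<and> card P * sum w T \<le> t * sum w P"
  using assms(2)
proof (induction rule: inc_induct)
  case base
  then show ?case by auto
next
  case (step t)
  then obtain T where T: "T \<subseteq> P" "card T = Suc t" "card P * sum w T \<le> Suc t * sum w P" by auto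
  have finT: "finite T" using T assms(1) finite_subset by blast
  have ne: "T \<noteq> {}" using T by auto
  obtain x where x: "x \<in> T" "\<forall>y\<in>T. w y \<le> w x"
    using finT ne Max_in[of "w ` T"] Max_ge[of "w ` T"] by fastforce
  have s: "sum w T = w x + sum w (T - {x})" using x finT by (simp add: sum.remove)
  have "sum w T \<le> (\<Sum>y\<in>T. w x)" using x by (intro sum_mono) auto
  then have "sum w T \<le> Suc t * w x" using T by simp
  then have "Suc t * sum w (T - {x}) \<le> t * sum w T" using s by (simp add: algebra_simps)
  then have "card P * (Suc t * sum w (T - {x})) \<le> card P * (t * sum w T)" by (rule mult_left_mono) auto
  also have "\<dots> = t * (card P * sum w T)" by simp
  also have "\<dots> \<le> t * (Suc t * sum w P)" using T by (intro mult_left_mono) auto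
  finally have "Suc t * (card P * sum w (T - {x})) \<le> Suc t * (t * sum w P)" by (simp add: algebra_simps)
  then have "card P * sum w (T - {x}) \<le> t * sum w P" by (metis Suc_mult_le_cancel1)
  then show ?case using T x finT by (intro exI[of _ "T - {x}"]) auto
qed

lemma split_equal_parts:
  assumes "finite T" "card T = N * r"
  shows "\<exists>Q. (\<forall>i<N. Q i \<subseteq> T \<and> card (Q i) = r) \<and> (\<forall>i<N. \<forall>j<N. i \<noteq> j \<longrightarrow> Q i \<inter> Q j = {})"
  using extend_to_equal_parts[of T N r "\<lambda>_. {}"] assms by auto

text \<open>Vertices are placed one at a time on the side where they have fewer neighbours, so at
  least half of the edges are cut. The left-hand sum counts each edge twice, whence the factor
  4.\<close>

lemma large_cut:
  assumes "finite X" "\<And>x. x \<notin> nbhd E x"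
  shows "\<exists>U\<subseteq>X. (\<Sum>v\<in>X. card (nbhd E v \<inter> X)) \<le> 4 * (\<Sum>v\<in>X - U. card (nbhd E v \<inter> U))"
  using assms(1)
proof (induction X rule: finite_induct)
  case empty
  then show ?case by simp
next
  case (insert x X)
  then obtain U where U: "U \<subseteq> X" "(\<Sum>v\<in>X. card (nbhd E v \<inter> X)) \<le> 4 * (\<Sum>v\<in>X - U. card (nbhd E v \<inter> U))"
    by blast
  have finU: "finite U" using U insert finite_subset by blast
  have ins: "card (nbhd E v \<inter> insert x Y) = card (nbhd E v \<inter> Y) + of_bool (v \<in> nbhd E x)" if "finite Y" "x \<notin> Y" for v Y
    using that by (auto simp: nbhd_sym[of x])
  have cnt: "(\<Sum>v\<in>Y. of_bool (v \<in> nbhd E x)) = card (nbhd E x \<inter> Y)" if "finite Y" for Y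
    using that by (simp add: of_bool_def sum.If_cases Int_commute Int_def)
  have 1: "(\<Sum>v\<in>insert x X. card (nbhd E v \<inter> insert x X)) = (\<Sum>v\<in>X. card (nbhd E v \<inter> X)) + 2 * card (nbhd E x \<inter> X)"
    using insert assms(2)[of x] by (simp add: ins sum.distrib cnt Int_commute)
  have 2: "card (nbhd E x \<inter> X) = card (nbhd E x \<inter> U) + card (nbhd E x \<inter> (X - U))"
    using U insert finU by (subst card_Un_disjoint[symmetric]) (auto intro!: arg_cong[of _ _ card])
  show ?case
  proof (cases "card (nbhd E x \<inter> (X - U)) \<le> card (nbhd E x \<inter> U)")
    case True
    have "insert x X - U = insert x (X - U)" using U insert by auto
    then have "(\<Sum>v\<in>insert x X - U. card (nbhd E v \<inter> U)) = card (nbhd E x \<inter> U) + (\<Sum>v\<in>X - U. card (nbhd E v \<inter> U))"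
      using insert by simp
    then show ?thesis using U 1 2 True by (intro exI[of _ U]) auto
  next
    case False
    have "insert x X - insert x U = X - U" using U insert by auto
    moreover have "(\<Sum>v\<in>X - U. card (nbhd E v \<inter> insert x U)) = (\<Sum>v\<in>X - U. card (nbhd E v \<inter> U)) + card (nbhd E x \<inter> (X - U))"
    proof -
      have "x \<notin> U" "finite (X - U)" using U insert by auto
      then show ?thesis using ins[OF finU] cnt[of "X - U"] by (simp only: sum.distrib not_False_eq_True)
    qed
    ultimately show ?thesis using U 1 2 False by (intro exI[of _ "insert x U"]) auto
  qed
qed

section \<open>Typical properties of the random graph\<close>

definition cross :: "nat set \<Rightarrow> nat set \<Rightarrow> nat set set" where
  "cross X Y = (\<lambda>(x, y). {x, y}) ` (X \<times> Y)"

lemma card_cross: "X \<inter> Y = {} \<Longrightarrow> card (cross X Y) = card X * card Y"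
  unfolding cross_def by (subst card_image) (auto simp: inj_on_def doubleton_eq_iff card_cartesian_product)

lemma cross_subset: "X \<subseteq> {..<n} \<Longrightarrow> Y \<subseteq> {..<n} \<Longrightarrow> X \<inter> Y = {} \<Longrightarrow> cross X Y \<subseteq> all_pairs n"
  unfolding cross_def all_pairs_def by safe (metis disjoint_iff lessThan_iff subsetD)

lemma cross_disjoint_iff: "cross X Y \<inter> H = {} \<longleftrightarrow> (\<forall>x\<in>X. \<forall>y\<in>Y. {x, y} \<notin> H)"
  unfolding cross_def by auto

lemma finite_all_pairs: "finite (all_pairs n)"
  by (rule finite_subset[of _ "Pow {..<n}"]) (auto simp: all_pairs_def)

lemma edge_prob_avoid_family:
  fixes p :: real
  assumes "0 \<le> p" "p \<le> 1" "finite I" "finite X" "\<And>i. M i \<subseteq> X"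
  shows "edge_prob X p (\<lambda>H. \<exists>i\<in>I. s \<le> card (M i) \<and> M i \<inter> H = {}) \<le> card I * (1 - p) ^ s"
  using edge_prob_avoid_exposed_family[OF assms(1-3), of "{}" X "\<lambda>i H. M i" s] assms(4,5) by simp

locale dense_gnp =
  fixes n :: nat and p C :: real
  assumes n2: "n \<ge> 2" and p1: "p \<le> 1" and C0: "C > 0" and pC: "C * ln n / n \<le> p"
begin

lemma p0: "0 \<le> p"
proof -
  have "0 \<le> C * ln n / n" using n2 C0 by simp
  then show ?thesis using pC by simp
qed

text \<open>Union bound: the \<open>2 * e\<close> vertices of a hole determine \<open>e * e\<close>
  missing pairs, and the hypothesis is \<open>union_bound_power\<close> for these numbers.\<close>

lemma prob_not_joined:
  assumes "real (2 * (e + e) + 2) * n \<le> C * real (e * e)"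
  shows "edge_prob (all_pairs n) p (\<lambda>H. \<not> joined n H e) \<le> 1 / real n ^ 2"
proof -
  let ?S = "{Z. Z \<subseteq> {..<n} \<and> card Z \<le> e}"
  \<comment> \<open>The intersection makes the target a subset of the ground set for every index,
    also when the two sets overlap.\<close>
  let ?M = "\<lambda>i. cross (fst i) (snd i) \<inter> all_pairs n"
  have "edge_prob (all_pairs n) p (\<lambda>H. \<not> joined n H e)
    \<le> edge_prob (all_pairs n) p (\<lambda>H. \<exists>i\<in>?S \<times> ?S. e * e \<le> card (?M i) \<and> ?M i \<inter> H = {})"
  proof (rule edge_prob_mono[OF p0 p1 finite_all_pairs])
    fix H assume "\<not> joined n H e"
    then have "\<exists>X Y. X \<subseteq> {..<n} \<and> Y \<subseteq> {..<n} \<and> X \<inter> Y = {} \<and> e \<le> card X \<and> e \<le> card Y \<and>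
        (\<forall>x\<in>X. \<forall>y\<in>Y. {x, y} \<notin> H)"
      unfolding joined_def by simp
    then obtain X Y where XY: "X \<subseteq> {..<n}" "Y \<subseteq> {..<n}" "X \<inter> Y = {}" "e \<le> card X" "e \<le> card Y"
      "\<forall>x\<in>X. \<forall>y\<in>Y. {x, y} \<notin> H"
      by (elim exE conjE) (rule that)
    obtain X' where X': "X' \<subseteq> X" "card X' = e" using XY obtain_subset_with_card_n by metis
    obtain Y' where Y': "Y' \<subseteq> Y" "card Y' = e" using XY obtain_subset_with_card_n by metis
    have d: "X' \<inter> Y' = {}" using X' Y' XY by auto
    have "cross X' Y' \<subseteq> all_pairs n" using X' Y' XY d by (intro cross_subset) auto
    then have "?M (X', Y') = cross X' Y'" by auto
    moreover have "cross X' Y' \<inter> H = {}" unfolding cross_disjoint_iff using XY(6) X'(1) Y'(1) by (meson subsetD)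
    ultimately show "\<exists>i\<in>?S \<times> ?S. e * e \<le> card (?M i) \<and> ?M i \<inter> H = {}"
      using X' Y' XY d by (intro bexI[of _ "(X', Y')"]) (auto simp: card_cross)
  qed
  also have "\<dots> \<le> card (?S \<times> ?S) * (1 - p) ^ (e * e)"
    by (rule edge_prob_avoid_family[OF p0 p1]) (simp_all only: finite_small_subsets finite_all_pairs finite_cartesian_product Int_lower2)
  also have "\<dots> \<le> real (n + 1) ^ (e + e) * (1 - p) ^ (e * e)"
  proof (rule mult_right_mono)
    have "card (?S \<times> ?S) \<le> (n + 1) ^ (e + e)"
      unfolding power_add card_cartesian_product by (intro mult_mono card_small_subsets_le) auto
    then show "real (card (?S \<times> ?S)) \<le> real (n + 1) ^ (e + e)"
      by (simp only: of_nat_power[symmetric] of_nat_le_iff)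
  qed (use p1 in auto)
  also have "\<dots> \<le> 1 / real n ^ 2"
    by (rule union_bound_power[OF n2 p1 pC C0 assms])
  finally show ?thesis .
qed

text \<open>If \<open>S\<close> of size \<open>s\<close> fails, its neighbourhood \<open>T\<close>
  in \<open>Q\<close> has fewer than \<open>K * s\<close> vertices, and \<open>S\<close> misses all
  of \<open>Q - T\<close>, at least \<open>w\<close> vertices. So at most \<open>s + K * s\<close>
  vertices determine \<open>s * w\<close> missing pairs. Summing \<open>1 / n^2\<close> over the at
  most \<open>n\<close> sizes gives \<open>1 / n\<close>.\<close>

lemma prob_not_expands:
  assumes "Q \<subseteq> {..<n}" "K * e + w \<le> card Q" "e \<le> n"
    and "\<And>s. 1 \<le> s \<Longrightarrow> s \<le> e \<Longrightarrow> real (2 * (s + K * s) + 2) * n \<le> C * real (s * w)"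
  shows "edge_prob (all_pairs n) p (\<lambda>H. \<not> expands n H Q e K) \<le> 1 / real n"
proof -
  let ?S = "\<lambda>k. {Z. Z \<subseteq> {..<n} \<and> card Z \<le> k}"
  let ?M = "\<lambda>i. cross (fst i - Q) (Q - snd i) \<inter> all_pairs n"
  let ?E = "\<lambda>s H. \<exists>i\<in>?S s \<times> ?S (K * s). s * w \<le> card (?M i) \<and> ?M i \<inter> H = {}"
  have finQ: "finite Q" using assms(1) finite_subset by blast
  have "edge_prob (all_pairs n) p (\<lambda>H. \<not> expands n H Q e K)
    \<le> edge_prob (all_pairs n) p (\<lambda>H. \<exists>s\<in>{1..e}. ?E s H)"
  proof (rule edge_prob_mono[OF p0 p1 finite_all_pairs])
    fix H assume "\<not> expands n H Q e K"
    then obtain S where S: "S \<subseteq> {..<n} - Q" "card S \<le> e"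
      "\<not> K * card S \<le> card {y\<in>Q. \<exists>x\<in>S. {x, y} \<in> H}" unfolding expands_def by auto
    define T where "T = {y\<in>Q. \<exists>x\<in>S. {x, y} \<in> H}"
    have T: "T \<subseteq> Q" "card T < K * card S" using S by (auto simp: T_def)
    have s: "1 \<le> card S" using T by (cases "card S") auto
    have d: "S - Q = S" "S \<inter> (Q - T) = {}" using S by auto
    have "cross S (Q - T) \<subseteq> all_pairs n" using S assms(1) by (intro cross_subset) auto
    then have M: "?M (S, T) = cross S (Q - T)" using d by auto
    have "cross S (Q - T) \<inter> H = {}" unfolding cross_disjoint_iff T_def by simp
    moreover have "card S * w \<le> card (cross S (Q - T))"
    proof -
      have "card (Q - T) = card Q - card T" using T finQ finite_subset by (intro card_Diff_subset) auto
      moreover have "K * card S \<le> K * e" using S by simp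
      ultimately have "w \<le> card (Q - T)" using assms(2) T by linarith
      then show ?thesis using d by (simp add: card_cross)
    qed
    ultimately have "?E (card S) H"
      using S T assms(1) M by (intro bexI[of _ "(S, T)"]) auto
    moreover have "card S \<in> {1..e}" using s S(2) by simp
    ultimately show "\<exists>s\<in>{1..e}. ?E s H" by (rule bexI)
  qed
  also have "\<dots> \<le> (\<Sum>s\<in>{1..e}. edge_prob (all_pairs n) p (?E s))"
    by (rule edge_prob_Ex_le[OF p0 p1 finite_all_pairs]) auto
  also have "\<dots> \<le> (\<Sum>s\<in>{1..e}. 1 / real n ^ 2)"
  proof (rule sum_mono)
    fix s assume s: "s \<in> {1..e}"
    have "edge_prob (all_pairs n) p (?E s) \<le> card (?S s \<times> ?S (K * s)) * (1 - p) ^ (s * w)"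
      by (rule edge_prob_avoid_family[OF p0 p1]) (simp_all only: finite_small_subsets finite_all_pairs finite_cartesian_product Int_lower2)
    also have "\<dots> \<le> real (n + 1) ^ (s + K * s) * (1 - p) ^ (s * w)"
    proof (rule mult_right_mono)
      have "card (?S s \<times> ?S (K * s)) \<le> (n + 1) ^ (s + K * s)"
        unfolding power_add card_cartesian_product by (intro mult_mono card_small_subsets_le) auto
      then show "real (card (?S s \<times> ?S (K * s))) \<le> real (n + 1) ^ (s + K * s)"
        by (simp only: of_nat_power[symmetric] of_nat_le_iff)
    qed (use p1 in auto)
    also have "\<dots> \<le> 1 / real n ^ 2"
      using s by (intro union_bound_power[OF n2 p1 pC C0] assms(4)) auto
    finally show "edge_prob (all_pairs n) p (?E s) \<le> 1 / real n ^ 2" .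
  qed
  also have "\<dots> = real e * (1 / real n ^ 2)" by simp
  also have "\<dots> \<le> real n * (1 / real n ^ 2)" using assms(3) by (intro mult_right_mono) auto
  also have "\<dots> = 1 / real n" by (simp add: power2_eq_square)
  finally show ?thesis .
qed

end

section \<open>Walks through successive layers, and linking cycles by two-round exposure\<close>

definition reach :: "nat set set \<Rightarrow> nat set \<Rightarrow> (nat \<Rightarrow> nat set) \<Rightarrow> nat \<Rightarrow> nat set" where
  "reach H S W k = {x. \<exists>u\<in>S. \<exists>xs. length xs = Suc k \<and> (\<forall>i\<le>k. xs ! i \<in> W i) \<and> walk H (u # xs) \<and> last xs = x}"

lemma reach_subset: "reach H S W k \<subseteq> W k"
proof
  fix x assume "x \<in> reach H S W k"
  then obtain xs where "length xs = Suc k" "\<forall>i\<le>k. xs ! i \<in> W i" "last xs = x"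
    unfolding reach_def by blast
  then show "x \<in> W k" by (metis diff_Suc_1 last_conv_nth le_refl length_0_conv nat.distinct(1))
qed

lemma reach_mono: "S \<subseteq> S' \<Longrightarrow> reach H S W k \<subseteq> reach H S' W k"
  unfolding reach_def by blast

text \<open>In each layer a set of size \<open>card S\<close> expands \<open>K\<close>-fold, and the
  bound on \<open>card Z\<close> leaves at least \<open>card S\<close> vertices after deleting
  \<open>Z\<close>. Expansion is known for \<open>H\<close>, but the walks have to lie in
  \<open>H'\<close>, later the part of \<open>H\<close> exposed first.\<close>

lemma card_reach:
  assumes "\<And>i. i \<le> k \<Longrightarrow> W i \<subseteq> {..<n} \<and> S \<inter> W i = {} \<and> expands n H (W i) e K"
    and "\<And>i j. i \<le> k \<Longrightarrow> j \<le> k \<Longrightarrow> i \<noteq> j \<Longrightarrow> W i \<inter> W j = {}"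
    and "\<And>x y i. i \<le> k \<Longrightarrow> x \<in> S \<union> (\<Union>i\<le>k. W i) \<Longrightarrow> y \<in> W i \<Longrightarrow> {x, y} \<in> H \<Longrightarrow> {x, y} \<in> H'"
    and "S \<subseteq> {..<n}" "finite Z" "card S \<le> e" "card Z + card S \<le> K * card S"
  shows "card S \<le> card (reach H' S (\<lambda>i. W i - Z) k)"
  using assms(1-3)
proof (induction k)
  case 0
  let ?N = "{y\<in>W 0. \<exists>x\<in>S. {x, y} \<in> H}"
  have fin: "finite (W 0)" using 0(1)[of 0] finite_subset by auto
  have "K * card S \<le> card ?N" using 0(1)[of 0] assms(4,6) by (intro expandsD) auto
  moreover have "card ?N - card Z \<le> card (?N - Z)" by (rule diff_card_le_card_Diff[OF assms(5)])
  ultimately have "card S \<le> card (?N - Z)" using assms(7) by linarith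
  also have "\<dots> \<le> card (reach H' S (\<lambda>i. W i - Z) 0)"
  proof (rule card_mono)
    show "finite (reach H' S (\<lambda>i. W i - Z) 0)"
      by (rule finite_subset[OF reach_subset]) (use fin in simp)
    show "?N - Z \<subseteq> reach H' S (\<lambda>i. W i - Z) 0"
    proof
      fix y assume y: "y \<in> ?N - Z"
      then obtain x where x: "x \<in> S" "{x, y} \<in> H" by blast
      then have "{x, y} \<in> H'" using 0(3)[of 0 x y] y by auto
      then show "y \<in> reach H' S (\<lambda>i. W i - Z) 0"
        using x y unfolding reach_def by (intro CollectI bexI[of _ x] exI[of _ "[y]"]) auto
    qed
  qed
  finally show ?case .
next
  case (Suc k)
  have IH: "card S \<le> card (reach H' S (\<lambda>i. W i - Z) k)"
  proof (rule Suc.IH)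
    fix x y i assume h: "i \<le> k" "x \<in> S \<union> (\<Union>i\<le>k. W i)" "y \<in> W i" "{x, y} \<in> H"
    have "(\<Union>i\<le>k. W i) \<subseteq> (\<Union>i\<le>Suc k. W i)" by (intro UN_mono) auto
    from subsetD[OF Un_mono[OF subset_refl this] h(2)] show "{x, y} \<in> H'"
      by (rule Suc.prems(3)[OF le_SucI[OF h(1)] _ h(3,4)])
  qed (use Suc.prems(1,2) in auto)
  then obtain R where R: "R \<subseteq> reach H' S (\<lambda>i. W i - Z) k" "card R = card S"
    using obtain_subset_with_card_n by metis
  have RW: "R \<subseteq> W k - Z" using R reach_subset by blast
  have p: "W k \<subseteq> {..<n}" "W k \<inter> W (Suc k) = {}" "expands n H (W (Suc k)) e K" "W (Suc k) \<subseteq> {..<n}"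
    using Suc.prems(1)[of k] Suc.prems(1)[of "Suc k"] Suc.prems(2)[of k "Suc k"] by auto
  let ?N = "{y\<in>W (Suc k). \<exists>x\<in>R. {x, y} \<in> H}"
  have "K * card S \<le> card ?N"
    unfolding R(2)[symmetric] using p RW assms(6) R(2) by (intro expandsD[OF p(3)]) auto
  moreover have "card ?N - card Z \<le> card (?N - Z)" by (rule diff_card_le_card_Diff[OF assms(5)])
  ultimately have "card S \<le> card (?N - Z)" using assms(7) by linarith
  also have "\<dots> \<le> card (reach H' S (\<lambda>i. W i - Z) (Suc k))"
  proof (rule card_mono)
    show "finite (reach H' S (\<lambda>i. W i - Z) (Suc k))"
      by (rule finite_subset[OF reach_subset]) (use p(4) finite_subset in auto)
    show "?N - Z \<subseteq> reach H' S (\<lambda>i. W i - Z) (Suc k)"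
    proof
      fix y assume y: "y \<in> ?N - Z"
      then obtain x where x: "x \<in> R" "{x, y} \<in> H" by blast
      then have "x \<in> W k" using RW by auto
      then have "x \<in> S \<union> (\<Union>i\<le>Suc k. W i)" by (meson UN_I UnI2 atMost_iff le_SucI le_refl)
      then have xy: "{x, y} \<in> H'" using Suc.prems(3)[of "Suc k" x y] x(2) y by simp
      from x R obtain u xs where u: "u \<in> S" "length xs = Suc k" "\<forall>i\<le>k. xs ! i \<in> W i - Z"
        "walk H' (u # xs)" "last xs = x" unfolding reach_def by blast
      have "xs \<noteq> []" using u(2) by auto
      then have "walk H' ((u # xs) @ [y])"
        using u(4,5) xy unfolding successively_append_iff by simp
      then have "walk H' (u # (xs @ [y]))" by (simp only: append_Cons)
      moreover have "\<forall>i\<le>Suc k. (xs @ [y]) ! i \<in> W i - Z" using u y by (auto simp: nth_append le_Suc_eq)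
      ultimately show "y \<in> reach H' S (\<lambda>i. W i - Z) (Suc k)"
        using u unfolding reach_def by (intro CollectI bexI[of _ u] exI[of _ "xs @ [y]"]) auto
    qed
  qed
  finally show ?case .
qed

text \<open>The pairs avoiding \<open>V\<close> are exposed first. For each \<open>v\<close> in
  \<open>V - Z\<close> they determine the ends of walks from the \<open>G\<close>-neighbours of
  \<open>v\<close> in \<open>U - Z\<close> through \<open>W 0\<close>, ..., \<open>W (q - 1)\<close>
  outside \<open>Z\<close>. By \<open>card_reach\<close> there are at least
  \<open>card (S v)\<close> ends, and a pair from \<open>v\<close> to any of them would close a
  cycle on \<open>q + 2\<close> vertices. Thus for some \<open>Z\<close> at least \<open>s\<close>
  pairs exposed later are all missing. Expansion is part of the event because its failure is bounded
  separately.\<close>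

lemma (in dense_gnp) prob_no_linking_cycle:
  assumes "1 \<le> q" "U \<subseteq> {..<n}" "V \<subseteq> {..<n}" "U \<inter> V = {}"
    and W: "\<And>i. i < q \<Longrightarrow> W i \<subseteq> {..<n} \<and> W i \<inter> (U \<union> V) = {}"
    and Wd: "\<And>i j. i < q \<Longrightarrow> j < q \<Longrightarrow> i \<noteq> j \<Longrightarrow> W i \<inter> W j = {}"
    and S: "\<And>Z. Z \<subseteq> {..<n} \<Longrightarrow> card Z \<le> z \<Longrightarrow> \<exists>S. (\<forall>v\<in>V - Z. S v \<subseteq> nbhd G v \<inter> U - Z \<and> card (S v) \<le> e \<and>
           (card Z + card (S v) \<le> K * card (S v) \<or> S v = {})) \<and> s \<le> (\<Sum>v\<in>V - Z. card (S v))"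
    and s: "real (2 * z + 2) * n \<le> C * real s"
  shows "edge_prob (all_pairs n) p (\<lambda>H. (\<forall>i<q. expands n H (W i) e K) \<and>
      \<not> (\<forall>Z. Z \<subseteq> {..<n} \<and> card Z \<le> z \<longrightarrow>
           (\<exists>c. is_cycle (G \<union> H) (q + 2) c \<and> set c \<subseteq> U \<union> V \<union> (\<Union>i<q. W i) - Z))) \<le> 1 / real n ^ 2"
    (is "edge_prob _ p ?F \<le> _")
proof -
  let ?Y = "{a\<in>all_pairs n. a \<inter> V = {}}" and ?X = "{a\<in>all_pairs n. a \<inter> V \<noteq> {}}"
  let ?Zs = "{Z. Z \<subseteq> {..<n} \<and> card Z \<le> z}"
  \<comment> \<open>The walks start from the whole remaining neighbourhood of \<open>v\<close>, so
    the target depends only on \<open>Z\<close> and the exposed pairs; the sets \<open>S v\<close>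
    bound its size from below.\<close>
  let ?R = "\<lambda>Z H v. reach H (nbhd G v \<inter> U - Z) (\<lambda>i. W i - Z) (q - 1)"
  let ?M = "\<lambda>Z H. {a. \<exists>v\<in>V - Z. \<exists>x\<in>?R Z H v. a = {x, v}} \<inter> all_pairs n"
  have q: "i \<le> q - 1 \<longleftrightarrow> i < q" for i using assms(1) by auto
  have YX: "?Y \<union> ?X = all_pairs n" by auto
  have "edge_prob (all_pairs n) p ?F \<le> edge_prob (all_pairs n) p
     (\<lambda>H. \<exists>Z\<in>?Zs. s \<le> card (?M Z (H \<inter> ?Y)) \<and> ?M Z (H \<inter> ?Y) \<inter> H = {})"
  proof (rule edge_prob_mono[OF p0 p1 finite_all_pairs])
    fix H assume H: "H \<subseteq> all_pairs n" and F: "?F H"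
    from F have ex: "\<And>i. i < q \<Longrightarrow> expands n H (W i) e K" by blast
    from F have "\<exists>Z. Z \<subseteq> {..<n} \<and> card Z \<le> z \<and>
        (\<forall>c. is_cycle (G \<union> H) (q + 2) c \<longrightarrow> \<not> set c \<subseteq> U \<union> V \<union> (\<Union>i<q. W i) - Z)" by simp
    then obtain Z where Z: "Z \<subseteq> {..<n}" "card Z \<le> z"
      and no: "\<forall>c. is_cycle (G \<union> H) (q + 2) c \<longrightarrow> \<not> set c \<subseteq> U \<union> V \<union> (\<Union>i<q. W i) - Z"
      by (elim exE conjE) (rule that)
    have finZ: "finite Z" using Z finite_subset by blast
    obtain S where S: "\<And>v. v \<in> V - Z \<Longrightarrow> S v \<subseteq> nbhd G v \<inter> U - Z \<and> card (S v) \<le> e \<and>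
           (card Z + card (S v) \<le> K * card (S v) \<or> S v = {})" "s \<le> (\<Sum>v\<in>V - Z. card (S v))"
      using S[OF Z] by blast
    let ?H = "H \<inter> ?Y"
    have RW: "?R Z ?H v \<subseteq> W (q - 1) - Z" for v using reach_subset[of ?H _ "\<lambda>i. W i - Z"] by simp
    have W1: "W (q - 1) \<subseteq> {..<n}" "W (q - 1) \<inter> V = {}" using W[of "q - 1"] assms(1) by auto
    have finR: "finite (?R Z ?H v)" for v
      by (rule finite_subset[OF RW]) (use W1(1) finite_subset in auto)
    have cR: "card (S v) \<le> card (?R Z ?H v)" if v: "v \<in> V - Z" for v
    proof (cases "S v = {}")
      case False
      have SvU: "S v \<subseteq> U" using S(1)[OF v] by auto
      have "card (S v) \<le> card (reach ?H (S v) (\<lambda>i. W i - Z) (q - 1))"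
      proof (rule card_reach[of "q - 1" W n "S v" H e K])
        fix i assume "i \<le> q - 1"
        then have "i < q" by (simp only: q)
        then show "W i \<subseteq> {..<n} \<and> S v \<inter> W i = {} \<and> expands n H (W i) e K"
          using W[of i] ex[of i] SvU by auto
      next
        fix x y i assume h: "i \<le> q - 1" "x \<in> S v \<union> (\<Union>i\<le>q - 1. W i)" "y \<in> W i" "{x, y} \<in> H"
        have Wi: "W i \<inter> V = {}" if "i \<le> q - 1" for i using W[of i] that unfolding q by auto
        have "x \<notin> V" using h(2) SvU assms(4) Wi by blast
        moreover have "y \<notin> V" using h(1,3) Wi by blast
        ultimately show "{x, y} \<in> ?H" using h(4) H by auto
      qed (use S(1)[OF v] False Wd finZ SvU assms(2) in \<open>auto simp: q\<close>)
      also have "\<dots> \<le> card (?R Z ?H v)" using S(1)[OF v] finR by (intro card_mono reach_mono) auto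
      finally show ?thesis .
    qed simp
    have "(\<Sum>v\<in>V - Z. card (S v)) \<le> (\<Sum>v\<in>V - Z. card (?R Z ?H v))" using cR by (rule sum_mono)
    also have "\<dots> = card (Sigma (V - Z) (?R Z ?H))"
      using finR finite_subset[OF assms(3)] by (intro card_SigmaI[symmetric]) auto
    \<comment> \<open>No pair is counted twice, since \<open>v\<close> is its only end in
      \<open>V\<close>.\<close>
    also have "\<dots> = card ((\<lambda>(v, x). {x, v}) ` Sigma (V - Z) (?R Z ?H))"
    proof (rule card_image[symmetric], rule inj_onI, safe)
      fix a b c d assume h: "a \<in> V" "b \<in> ?R Z ?H a" "c \<in> V" "d \<in> ?R Z ?H c" "{b, a} = {d, c}"
      have "b \<notin> V" "d \<notin> V" using h(2,4) RW W1 by blast+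
      then show "a = c" "b = d" using h by (auto simp: doubleton_eq_iff)
    qed
    also have "\<dots> \<le> card (?M Z ?H)"
    proof (rule card_mono)
      show "(\<lambda>(v, x). {x, v}) ` Sigma (V - Z) (?R Z ?H) \<subseteq> ?M Z ?H"
      proof safe
        fix v x assume h: "v \<in> V" "x \<in> ?R Z ?H v"
        have "x \<in> W (q - 1)" using h RW by blast
        then have "x < n" "v < n" "x \<noteq> v" using W1 h(1) assms(3) by auto
        then show "{x, v} \<in> all_pairs n" unfolding all_pairs_def by blast
      qed auto
    qed (simp add: finite_all_pairs)
    finally have 1: "s \<le> card (?M Z ?H)" using S(2) by linarith
    have 2: "?M Z ?H \<inter> H = {}"
    proof (rule ccontr)
      assume "?M Z ?H \<inter> H \<noteq> {}"
      then obtain v x where v: "v \<in> V - Z" "x \<in> ?R Z ?H v" "{x, v} \<in> H" by blast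
      then obtain u xs where u: "u \<in> nbhd G v \<inter> U - Z" "length xs = Suc (q - 1)"
        "\<forall>i\<le>q - 1. xs ! i \<in> W i - Z" "walk ?H (u # xs)" "last xs = x" unfolding reach_def by blast
      have lxs: "length xs = q" using u(2) assms(1) by simp
      have xsW: "xs ! i \<in> W i - Z" if "i < q" for i using u(3) that by (simp add: q)
      \<comment> \<open>The disjoint layers turn the walk into a path; hence \<open>reach\<close>
        demands no distinctness.\<close>
      have dxs: "distinct xs" unfolding distinct_conv_nth lxs using xsW Wd by fastforce
      have sxs: "set xs \<subseteq> (\<Union>i<q. W i) - Z" unfolding set_conv_nth lxs using xsW by auto
      have WUV: "(\<Union>i<q. W i) \<inter> (U \<union> V) = {}" using W by auto
      have ne: "xs \<noteq> []" using lxs assms(1) by auto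
      have "is_cycle (G \<union> H) (q + 2) (v # u # xs)"
      proof (rule is_cycleI)
        show "distinct (v # u # xs)" using dxs sxs WUV u(1) v(1) assms(4) by auto
        have "walk (G \<union> H) (u # xs)" using u(4) by (rule successively_mono) auto
        moreover have "{v, u} \<in> G" using u(1) by (auto simp: nbhd_def)
        ultimately show "walk (G \<union> H) (v # u # xs)" by simp
        show "{last (v # u # xs), hd (v # u # xs)} \<in> G \<union> H" using v(3) u(5) ne by simp
      qed (use lxs in auto)
      moreover have "set (v # u # xs) \<subseteq> U \<union> V \<union> (\<Union>i<q. W i) - Z" using sxs u(1) v(1) by auto
      ultimately show False using no by blast
    qed
    show "\<exists>Z\<in>?Zs. s \<le> card (?M Z ?H) \<and> ?M Z ?H \<inter> H = {}" using 1 2 Z by blast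
  qed
  also have "\<dots> \<le> card ?Zs * (1 - p) ^ s"
    using edge_prob_avoid_exposed_family[OF p0 p1, of ?Zs ?Y ?X ?M s] finite_all_pairs
    unfolding YX by (auto simp: finite_small_subsets)
  also have "\<dots> \<le> real (n + 1) ^ z * (1 - p) ^ s"
  proof (rule mult_right_mono)
    show "real (card ?Zs) \<le> real (n + 1) ^ z"
      using card_small_subsets_le[of n z] by (simp only: of_nat_power[symmetric] of_nat_le_iff)
  qed (use p1 in auto)
  also have "\<dots> \<le> 1 / real n ^ 2" by (rule union_bound_power[OF n2 p1 pC C0 s])
  finally show ?thesis .
qed

section \<open>Covering a nearly complete pair\<close>

text \<open>Hall's condition: a nonempty \<open>J\<close> with at most \<open>t\<close> members is
  served by the neighbours of a single member, and a \<open>J\<close> with more than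
  \<open>t\<close> members sees all of \<open>A\<close>, because each \<open>a\<close> is excluded
  by at most \<open>t\<close> indices.\<close>

lemma marriage_dense:
  assumes "finite I" "finite A" "card I = card A" "\<And>i. i \<in> I \<Longrightarrow> N i \<subseteq> A \<and> t \<le> card (N i)"
    and "\<And>a. a \<in> A \<Longrightarrow> card {i\<in>I. a \<notin> N i} \<le> t"
  shows "\<exists>f. inj_on f I \<and> (\<forall>i\<in>I. f i \<in> N i)"
proof (rule marriage[OF assms(1)])
  show "finite (N i)" if "i \<in> I" for i using assms(2,4) that finite_subset by blast
  fix J assume J: "J \<subseteq> I"
  have finJ: "finite J" using J assms(1) finite_subset by blast
  have UA: "(\<Union>i\<in>J. N i) \<subseteq> A" using assms(4) J by blast
  show "card J \<le> card (\<Union>i\<in>J. N i)"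
  proof (cases "card J \<le> t")
    case True
    show ?thesis
    proof (cases "J = {}")
      case False
      then obtain i where i: "i \<in> J" by blast
      then have "t \<le> card (N i)" using assms(4) J by blast
      also have "\<dots> \<le> card (\<Union>i\<in>J. N i)"
        using i UA assms(2) by (intro card_mono finite_subset[OF UA]) auto
      finally show ?thesis using True by simp
    qed simp
  next
    case False
    have "A \<subseteq> (\<Union>i\<in>J. N i)"
    proof
      fix a assume a: "a \<in> A"
      show "a \<in> (\<Union>i\<in>J. N i)"
      proof (rule ccontr)
        assume "a \<notin> (\<Union>i\<in>J. N i)"
        then have "J \<subseteq> {i\<in>I. a \<notin> N i}" using J by auto
        then have "card J \<le> card {i\<in>I. a \<notin> N i}" using assms(1) by (intro card_mono) auto
        then show False using assms(5)[OF a] False by simp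
      qed
    qed
    then have "card A \<le> card (\<Union>i\<in>J. N i)" using assms(2) finite_subset[OF UA] by (intro card_mono) auto
    then show ?thesis using J assms(1,3) card_mono[of I J] by simp
  qed
qed

text \<open>The chain supplies \<open>k\<close> disjoint paths, and \<open>h j\<close>, which lies
  outside all parts, closes the \<open>j\<close>-th of them because it is adjacent in
  \<open>G\<close> to both ends.\<close>

lemma packs_from_chain:
  assumes "2 \<le> q"
    and g: "\<And>i. i < q \<Longrightarrow> bij_betw (g i) {..<k} (W i)"
    and gH: "\<And>i j. Suc i < q \<Longrightarrow> j < k \<Longrightarrow> {g i j, g (Suc i) j} \<in> H"
    and W: "\<And>i j. i < q \<Longrightarrow> j < q \<Longrightarrow> i \<noteq> j \<Longrightarrow> W i \<inter> W j = {}"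
    and h: "inj_on h {..<k}" "\<And>j i. j < k \<Longrightarrow> i < q \<Longrightarrow> h j \<notin> W i"
    and hG: "\<And>j. j < k \<Longrightarrow> {h j, g 0 j} \<in> G \<and> {h j, g (q - 1) j} \<in> G"
  shows "packs (G \<union> H) (Suc q) k (h ` {..<k} \<union> (\<Union>i<q. W i))"
proof -
  let ?p = "\<lambda>j. map (\<lambda>i. g i j) [0..<q]"
  have gW: "g i j \<in> W i" if "i < q" "j < k" for i j using g[OF that(1)] that bij_betwE by blast
  have g_eq: "i = i' \<and> j = j'" if "g i j = g i' j'" "i < q" "j < k" "i' < q" "j' < k" for i j i' j'
  proof -
    have "g i j \<in> W i" using gW that(2,3) by simp
    moreover have "g i j \<in> W i'" unfolding that(1) using gW that(4,5) by simp
    ultimately have "i = i'" using W[of i i'] that(2,4) by (meson disjoint_iff)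
    moreover have "j = j'"
      by (rule inj_onD[OF bij_betw_imp_inj_on[OF g[OF that(2)]]]) (use that \<open>i = i'\<close> in auto)
    ultimately show ?thesis by simp
  qed
  have "is_cycle (G \<union> H) (Suc q) (h j # ?p j)" if j: "j < k" for j
  proof (rule is_cycleI)
    have "inj_on (\<lambda>i. g i j) {0..<q}"
    proof (rule inj_onI)
      fix a b assume "a \<in> {0..<q}" "b \<in> {0..<q}" "g a j = g b j"
      then show "a = b" using g_eq[of a j b j] j by simp
    qed
    then have "distinct (?p j)" by (simp add: distinct_map)
    moreover have "h j \<notin> set (?p j)" 
    proof
      assume "h j \<in> set (?p j)"
      then obtain i where "i < q" "h j = g i j" by auto
      then show False using h(2)[OF j, of i] gW[of i j] j by simp
    qed
    ultimately show "distinct (h j # ?p j)" by simp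
    have "walk (G \<union> H) (?p j)" using gH j by (auto simp: successively_conv_nth)
    moreover have "hd (?p j) = g 0 j" "last (?p j) = g (q - 1) j" "?p j \<noteq> []"
      using assms(1) by (auto simp: hd_map last_map)
    ultimately show "walk (G \<union> H) (h j # ?p j)" "{last (h j # ?p j), hd (h j # ?p j)} \<in> G \<union> H"
      using hG[OF j] by (auto simp: successively_Cons insert_commute)
  qed auto
  moreover have "set (h i # ?p i) \<inter> set (h j # ?p j) = {}" if "i < k" "j < k" "i \<noteq> j" for i j
  proof -
    have "h i \<noteq> h j" using that h(1) by (auto simp: inj_on_def)
    moreover have "set (?p i) \<inter> set (?p j) = {}"
    proof (rule ccontr)
      assume "set (?p i) \<inter> set (?p j) \<noteq> {}"
      then obtain x where "x \<in> set (?p i)" "x \<in> set (?p j)" by blast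
      then obtain a b where "a < q" "b < q" "g a i = g b j" by auto
      then show False using g_eq[of a i b j] that by simp
    qed
    moreover have hp: "h i \<notin> set (?p j)" if "i < k" "j < k" for i j
    proof
      assume "h i \<in> set (?p j)"
      then obtain a where "a < q" "h i = g a j" by auto
      then show False using h(2)[OF that(1), of a] gW[of a j] that by simp
    qed
    moreover have "h i \<notin> set (?p j)" "h j \<notin> set (?p i)" using hp that by blast+
    ultimately show ?thesis by simp
  qed
  moreover have "(\<Union>j<k. set (h j # ?p j)) = h ` {..<k} \<union> (\<Union>i<q. W i)"
  proof -
    have "(\<Union>j<k. set (?p j)) = (\<Union>i<q. g i ` {..<k})" by auto
    also have "\<dots> = (\<Union>i<q. W i)" using g by (auto simp: bij_betw_def)
    finally have "(\<Union>j<k. set (?p j)) = (\<Union>i<q. W i)" .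
    moreover have "(\<Union>j<k. set (h j # ?p j)) = h ` {..<k} \<union> (\<Union>j<k. set (?p j))" by auto
    ultimately show ?thesis by (simp only:)
  qed
  ultimately show ?thesis unfolding packs_def by (intro exI[of _ "\<lambda>j. h j # ?p j"]) blast
qed

text \<open>The factor \<open>128 l\<close> in \<open>K\<close> lets the random neighbourhood of at least \<open>d / 128\<close> vertices
  survive the deletion of any \<open>l d\<close> vertices; see \<open>linking_sources\<close>.\<close>

locale stable_pair =
  fixes n l e K m :: nat and G :: "nat set set" and A B :: "nat set" and \<alpha> \<beta> :: real
  assumes l3: "3 \<le> l" and K: "K = 128 * l + 1"
    and e_beta: "1000 * (l * (\<beta> * n)) \<le> e"
    and e_alpha: "1000 * (l * real (4 * l * K * e)) \<le> \<alpha> * n"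
    and alpha_l: "l * (\<alpha> * n) \<le> n"
    and beta_n: "1 \<le> \<beta> * n"
    and graph: "is_graph n G"
    and AB: "A \<union> B = {..<n}" "A \<inter> B = {}"
    and cardA: "\<alpha> * n - \<beta> * n \<le> card A" "card A \<le> \<alpha> * n + \<beta> * n"
    and degA: "\<And>v. v \<in> A \<Longrightarrow> \<alpha> * n / 4 \<le> card (nbhd G v \<inter> B)"
    and degB: "\<And>v. v \<in> B \<Longrightarrow> \<alpha> * n / 4 \<le> card (nbhd G v \<inter> A)"
    and excA: "card {v\<in>A. card (nbhd G v \<inter> B) < card B - \<beta> * n} \<le> \<beta> * n"
    and excB: "card {v\<in>B. card (nbhd G v \<inter> A) < card A - \<beta> * n} \<le> \<beta> * n"
    and edgesB: "card {a\<in>G. a \<subseteq> B} \<le> \<beta> * n * n"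
    and m: "\<alpha> * n - \<beta> * n - 1 \<le> m" "m \<le> \<alpha> * n" "l * m \<le> n"
    and degree: "\<And>v. v < n \<Longrightarrow> m \<le> card (nbhd G v)"
begin

definition XA where "XA = {v\<in>A. card (nbhd G v \<inter> B) < card B - \<beta> * n}"
definition XB where "XB = {v\<in>B. card (nbhd G v \<inter> A) < card A - \<beta> * n}"

lemma fin: "finite A" "finite B"
  using AB by (metis finite_Un finite_lessThan)+

lemma card_AB: "card A + card B = n"
  using AB fin by (metis card_Un_disjoint card_lessThan)

text \<open>The scales \<open>l * \<beta> * n\<close>, \<open>l * e\<close>,
  \<open>4 * l * K * e\<close> and \<open>\<alpha> * n\<close> increase by factors of at least 1000.
  Later estimates compare a main term with errors of lower scales, so linear arithmetic
  suffices.\<close>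

lemma scale:
  shows "3 * (\<alpha> * n) \<le> n" "1000 * real (4 * l * K * e) \<le> \<alpha> * n" "1000 * real (l * e) \<le> real (4 * l * K * e)"
    "1000 * (l * (\<beta> * n)) \<le> e" "1000 * (\<beta> * n) \<le> e" "1 \<le> \<beta> * n" "1 \<le> e" "real e \<le> real (l * e)"
    "real (2 * (l - 1) * e) \<le> 2 * real (l * e)" "real (2 * K * e) \<le> real (4 * l * K * e)"
    "e \<le> l * e"
proof -
  have l: "3 \<le> real l" using l3 by simp
  have e0: "0 \<le> real (4 * l * K * e)" by simp
  have "1000 * real (4 * l * K * e) * 1 \<le> 1000 * real (4 * l * K * e) * l"
    using l by (intro mult_left_mono) auto
  then show 1: "1000 * real (4 * l * K * e) \<le> \<alpha> * n" using e_alpha by (simp add: algebra_simps)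
  then have "0 \<le> \<alpha> * n" using e0 by linarith
  then have "3 * (\<alpha> * n) \<le> l * (\<alpha> * n)" using l by (intro mult_right_mono) auto
  then show "3 * (\<alpha> * n) \<le> n" using alpha_l by linarith
  \<comment> \<open>Since \<open>l \<ge> 3\<close>, \<open>4 * K\<close> is at least 1540.\<close>
  have "1000 * (l * e) \<le> (4 * K) * (l * e)" using K l3 by (intro mult_right_mono) auto
  then have "1000 * (l * e) \<le> 4 * l * K * e" by (simp add: algebra_simps)
  then show "1000 * real (l * e) \<le> real (4 * l * K * e)" by (metis of_nat_le_iff of_nat_mult of_nat_numeral)
  show "1000 * (l * (\<beta> * n)) \<le> e" by (rule e_beta)
  have "1 * (\<beta> * n) \<le> l * (\<beta> * n)" using l beta_n by (intro mult_right_mono) auto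
  then show "1000 * (\<beta> * n) \<le> e" using e_beta by linarith
  then show "1 \<le> e" using beta_n by linarith
  show "1 \<le> \<beta> * n" by (rule beta_n)
  show el: "e \<le> l * e" using l3 by simp
  show "real e \<le> real (l * e)" using el by linarith
  have "(l - 1) * e \<le> l * e" by (intro mult_right_mono) auto
  then have "2 * (l - 1) * e \<le> 2 * (l * e)" by simp
  then show "real (2 * (l - 1) * e) \<le> 2 * real (l * e)" by (metis of_nat_le_iff of_nat_mult of_nat_numeral)
  have "1 * (2 * K * e) \<le> (2 * l) * (2 * K * e)" using l3 by (intro mult_right_mono) auto
  then have "2 * K * e \<le> 4 * l * K * e" by (simp only: mult.assoc mult.left_commute)
  then show "real (2 * K * e) \<le> real (4 * l * K * e)" by linarith
qed

text \<open>Every cycle uses one vertex of \<open>A1\<close> and \<open>l - 1\<close> of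
  \<open>B - U0\<close>, so the last assumption is the necessary counting condition. As
  \<open>A1\<close> misses at most \<open>6 * \<beta> * n\<close> vertices of \<open>A\<close>,
  typical vertices of \<open>B\<close> still see almost all of it.\<close>

lemma cover_by_disjoint_cycles:
  assumes jn: "joined n H e"
    and Q: "\<And>i. i < l - 1 \<Longrightarrow> Q i \<subseteq> B - XB \<and> card (Q i) = 2 * K * e \<and> expands n H (Q i) e K \<and> Q i \<inter> U0 = {}"
    and Qd: "\<And>i j. i < l - 1 \<Longrightarrow> j < l - 1 \<Longrightarrow> i \<noteq> j \<Longrightarrow> Q i \<inter> Q j = {}"
    and A1: "A1 \<subseteq> A" "card A \<le> card A1 + 6 * (\<beta> * n)" "U0 \<inter> A1 = {}"
    and U0: "finite U0" "card U0 \<le> 3 * (l * (\<beta> * n))" "(l - 1) * card A1 \<le> card (B - U0)"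
  shows "\<exists>U. packs (G \<union> H) l (card A1) U \<and> U \<inter> U0 = {}"
proof -
  define X where "X = XA \<inter> A1"
  define R where "R = (\<Union>i<l-1. Q i)"
  define Y where "Y = B - R - U0"
  have finX: "finite X" unfolding X_def using A1 fin finite_subset by blast
  have cX: "card X \<le> \<beta> * n"
  proof -
    have "card X \<le> card XA" unfolding X_def using fin by (intro card_mono) (auto simp: XA_def)
    then show ?thesis using excA unfolding XA_def by linarith
  qed
  have QB: "Q i \<subseteq> B" if "i < l - 1" for i using Q[OF that] by blast
  have finQ: "finite (Q i)" if "i < l - 1" for i using QB[OF that] fin finite_subset by blast
  have finR: "finite R" unfolding R_def using finQ by auto
  have "card R \<le> (\<Sum>i<l-1. card (Q i))" unfolding R_def by (rule card_UN_le) simp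
  also have "\<dots> = (l - 1) * (2 * K * e)" using Q by simp
  also have "\<dots> \<le> (2 * l) * (2 * K * e)" by (intro mult_right_mono) auto
  finally have "card R \<le> 4 * l * K * e" by (simp add: algebra_simps)
  then have cR: "real (card R) \<le> real (4 * l * K * e)" by (simp only: of_nat_le_iff)
  have star: "\<exists>U. packs (G \<union> H) l (card X) U \<and> X \<subseteq> U \<and> U \<subseteq> X \<union> Y"
  proof (rule pack_stars[OF jn _ l3 finX])
    show "Y \<subseteq> {..<n}" "X \<inter> Y = {}" using AB by (auto simp: Y_def X_def XA_def)
    fix x assume x: "x \<in> X"
    have "card (nbhd G x \<inter> B) \<le> card ((nbhd G x \<inter> Y) \<union> (R \<union> U0))"
      using finR U0 fin by (intro card_mono) (auto simp: Y_def)
    also have "\<dots> \<le> card (nbhd G x \<inter> Y) + (card R + card U0)"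
      by (meson card_Un_le add_left_mono order_trans)
    finally have 1: "card (nbhd G x \<inter> B) \<le> card (nbhd G x \<inter> Y) + (card R + card U0)" .
    have 2: "\<alpha> * n / 4 \<le> card (nbhd G x \<inter> B)" using degA x by (auto simp: X_def XA_def)
    have "real (l - 1) * real (card X) \<le> l * (\<beta> * n)" using cX by (intro mult_mono) auto
    then have "real ((l - 1) * card X) \<le> l * (\<beta> * n)" by simp
    then have "real ((l - 1) * card X + 2 * (l - 1) * e) \<le> card (nbhd G x \<inter> Y)"
      using 1 2 cR U0(2) scale unfolding of_nat_add by linarith
    then show "(l - 1) * card X + 2 * (l - 1) * e \<le> card (nbhd G x \<inter> Y)" by linarith
  qed (use scale in auto)
  then obtain U1 where U1: "packs (G \<union> H) l (card X) U1" "X \<subseteq> U1" "U1 \<subseteq> X \<union> Y" by blast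
  note U1c = packs_card[OF U1(1)]
  define A' where "A' = A1 - X"
  define B' where "B' = B - U0 - U1"
  define k where "k = card A'"
  have finA': "finite A'" unfolding A'_def using A1 fin finite_subset by blast
  have cA1: "card A1 = card X + k"
  proof -
    have "A1 = X \<union> A'" "X \<inter> A' = {}" by (auto simp: A'_def X_def)
    then show ?thesis unfolding k_def using finX finA' by (metis card_Un_disjoint)
  qed
  have XBd: "X \<inter> B = {}" using AB by (auto simp: X_def XA_def)
  have "card U1 = card X + card (U1 \<inter> B)"
  proof -
    have "U1 = X \<union> (U1 \<inter> B)" using U1 by (auto simp: Y_def)
    then have "card U1 = card (X \<union> (U1 \<inter> B))" by simp
    also have "\<dots> = card X + card (U1 \<inter> B)" using finX fin XBd by (intro card_Un_disjoint) auto
    finally show ?thesis .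
  qed
  then have U1B: "card (U1 \<inter> B) = (l - 1) * card X" using U1c by (simp add: diff_mult_distrib)
  have "card (B - U0) \<le> card B' + card (U1 \<inter> B)"
  proof -
    have "card (B - U0) \<le> card (B' \<union> (U1 \<inter> B))" using fin by (intro card_mono) (auto simp: B'_def)
    then show ?thesis using card_Un_le order_trans by blast
  qed
  then have cB': "(l - 1) * k \<le> card B'" using U0(3) U1B cA1 by (simp add: distrib_left)
  have finB': "finite B'" using fin by (simp add: B'_def)
  have kbig: "\<alpha> * n - 8 * (\<beta> * n) \<le> k" using cA1 A1(2) cX cardA by linarith
  \<comment> \<open>All atypical vertices of \<open>B'\<close> go to the first part, so that the
    last vertex \<open>g (l - 2) j\<close> of each path lies outside \<open>XB\<close>.\<close>
  define S where "S i = Q i \<union> (if i = 0 then XB \<inter> B' else {})" for i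
  have QB': "Q i \<subseteq> B'" if "i < l - 1" for i
  proof -
    have "Q i \<subseteq> R" using that by (auto simp: R_def)
    then show ?thesis using Q[OF that] U1(3) XBd by (auto simp: B'_def Y_def)
  qed
  have "\<exists>W. (\<forall>i<l-1. S i \<subseteq> W i \<and> W i \<subseteq> B' \<and> card (W i) = k) \<and> (\<forall>i<l-1. \<forall>j<l-1. i \<noteq> j \<longrightarrow> W i \<inter> W j = {})"
  proof (rule extend_to_equal_parts[OF finB' cB'])
    fix i assume i: "i < l - 1"
    have "card (XB \<inter> B') \<le> card XB" using fin by (intro card_mono) (auto simp: XB_def)
    then have "card (S i) \<le> 2 * K * e + card XB"
      unfolding S_def using card_Un_le[of "Q i" "XB \<inter> B'"] Q[OF i] by auto
    moreover have "real (2 * K * e) + card XB \<le> k"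
      using excB kbig scale unfolding XB_def[symmetric] by linarith
    then have "2 * K * e + card XB \<le> k" by (simp only: of_nat_add[symmetric] of_nat_le_iff)
    ultimately show "S i \<subseteq> B' \<and> card (S i) \<le> k"
      using QB'[OF i] by (auto simp: S_def)
  next
    fix i j assume ij: "i < l - 1" "j < l - 1" "i \<noteq> j"
    then show "S i \<inter> S j = {}" using Qd[OF ij] Q[of i] Q[of j] by (auto simp: S_def)
  qed
  then obtain W where "\<forall>i<l-1. S i \<subseteq> W i \<and> W i \<subseteq> B' \<and> card (W i) = k"
    "\<forall>i<l-1. \<forall>j<l-1. i \<noteq> j \<longrightarrow> W i \<inter> W j = {}" by (elim exE conjE) (rule that)
  then have W: "\<And>i. i < l - 1 \<Longrightarrow> S i \<subseteq> W i \<and> W i \<subseteq> B' \<and> card (W i) = k"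
    "\<And>i j. i < l - 1 \<Longrightarrow> j < l - 1 \<Longrightarrow> i \<noteq> j \<Longrightarrow> W i \<inter> W j = {}" by simp_all
  have lq: "i \<le> l - 2 \<longleftrightarrow> i < l - 1" for i using l3 by auto
  have "\<exists>g. (\<forall>i\<le>l-2. bij_betw (g i) {..<k} (W i)) \<and> (\<forall>i<l-2. \<forall>j<k. {g i j, g (Suc i) j} \<in> H)"
  proof (rule expander_matching_chain[OF jn, of K "l - 2" W k Q])
    fix i assume "i \<le> l - 2"
    then have i: "i < l - 1" by (simp only: lq)
    have "B' \<subseteq> {..<n}" using AB by (auto simp: B'_def)
    then show "W i \<subseteq> {..<n} \<and> card (W i) = k \<and> Q i \<subseteq> W i \<and> expands n H (Q i) e K"
      using W(1)[OF i] Q[OF i] by (auto simp: S_def)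
  next
    show "W i \<inter> W j = {}" if "i \<le> l - 2" "j \<le> l - 2" "i \<noteq> j" for i j
      using W(2) that unfolding lq by blast
  qed (use scale(7) K in auto)
  then obtain g where g: "\<And>i. i < l - 1 \<Longrightarrow> bij_betw (g i) {..<k} (W i)"
    "\<And>i j. i < l - 2 \<Longrightarrow> j < k \<Longrightarrow> {g i j, g (Suc i) j} \<in> H" unfolding lq by blast
  define N where "N j = {a\<in>A'. {a, g 0 j} \<in> G \<and> {a, g (l - 2) j} \<in> G}" for j
  have gB: "g i j \<in> W i" "g i j \<in> B" if "i < l - 1" "j < k" for i j
    using bij_betwE[OF g(1)[OF that(1)]] that W(1)[OF that(1)] by (auto simp: B'_def)
  have cAA: "real (card (A - A')) \<le> 7 * (\<beta> * n)"
  proof -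
    have "A' \<subseteq> A" using A1 by (auto simp: A'_def)
    then have "card (A - A') = card A - k" "k \<le> card A"
      unfolding k_def using finA' fin by (auto simp: card_Diff_subset intro: card_mono)
    then show ?thesis using A1(2) cA1 cX by linarith
  qed
  \<comment> \<open>A vertex \<open>a\<close> of \<open>A'\<close> has at most
    \<open>\<beta> * n\<close> non-neighbours in \<open>B\<close>, each of which is the first vertex
    of at most one path and the last of at most one. So at most \<open>2 * \<beta> * n\<close> paths
    exclude \<open>a\<close>, while each path keeps at least
    \<open>\<alpha> * n / 4 - 8 * \<beta> * n\<close> candidates.\<close>
  have "\<exists>f. inj_on f {..<k} \<and> (\<forall>j\<in>{..<k}. f j \<in> N j)"
  proof (rule marriage_dense[where A = A' and t = "nat \<lceil>2 * (\<beta> * n)\<rceil>"])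
    fix j assume j: "j \<in> {..<k}"
    have b0: "g 0 j \<in> B" using gB[of 0 j] j l3 by auto
    have b1: "g (l - 2) j \<in> B - XB"
    proof -
      have "g (l - 2) j \<in> W (l - 2)" using gB(1)[of "l - 2" j] j l3 by auto
      moreover have "W (l - 2) \<inter> W 0 = {}" using W(2)[of "l - 2" 0] l3 by auto
      moreover have "W (l - 2) \<subseteq> B'" using W(1)[of "l - 2"] l3 by auto
      moreover have "XB \<inter> B' \<subseteq> W 0" using W(1)[of 0] l3 by (auto simp: S_def)
      ultimately show ?thesis by (auto simp: B'_def)
    qed
    let ?N0 = "nbhd G (g 0 j) \<inter> A" and ?N1 = "nbhd G (g (l - 2) j) \<inter> A"
    have 0: "\<alpha> * n / 4 \<le> card ?N0" using degB[OF b0] .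
    have 1: "card A - \<beta> * n \<le> card ?N1" using b1 by (auto simp: XB_def)
    have "card (A - ?N1) = card A - card ?N1" "card ?N1 \<le> card A" using fin by (auto simp: card_Diff_subset intro: card_mono)
    then have 2: "real (card (A - ?N1)) \<le> \<beta> * n" using 1 by linarith
    have "card ?N0 \<le> card (N j \<union> ((A - A') \<union> (A - ?N1)))"
      using fin finA' by (intro card_mono) (auto simp: N_def nbhd_def insert_commute)
    also have "\<dots> \<le> card (N j) + (card (A - A') + card (A - ?N1))"
      by (meson card_Un_le add_left_mono order_trans)
    finally have "real (card ?N0) \<le> card (N j) + (card (A - A') + card (A - ?N1))" by linarith
    then have "2 * (\<beta> * n) + 1 \<le> card (N j)" using 0 2 cAA scale by linarith
    then have "nat \<lceil>2 * (\<beta> * n)\<rceil> \<le> card (N j)" by linarith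
    then show "N j \<subseteq> A' \<and> nat \<lceil>2 * (\<beta> * n)\<rceil> \<le> card (N j)" by (auto simp: N_def)
  next
    fix a assume a: "a \<in> A'"
    then have aX: "a \<in> A" "a \<notin> XA" using A1 by (auto simp: A'_def X_def)
    let ?M = "B - nbhd G a"
    have "card ?M = card B - card (nbhd G a \<inter> B)" "card (nbhd G a \<inter> B) \<le> card B"
      using fin card_Diff_subset_Int[of B "nbhd G a"] by (auto simp: Int_commute intro: card_mono)
    moreover have "card B - \<beta> * n \<le> card (nbhd G a \<inter> B)" using aX by (auto simp: XA_def)
    ultimately have M: "real (card ?M) \<le> \<beta> * n" by linarith
    have *: "card {j\<in>{..<k}. g i j \<in> ?M} \<le> card ?M" if "i < l - 1" for i
      using fin bij_betw_imp_inj_on[OF g(1)[OF that]]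
      by (intro card_inj_on_le[of "g i"]) (auto simp: inj_on_def)
    have "card {j\<in>{..<k}. a \<notin> N j} \<le> card ({j\<in>{..<k}. g 0 j \<in> ?M} \<union> {j\<in>{..<k}. g (l - 2) j \<in> ?M})"
    proof (rule card_mono)
      show "{j\<in>{..<k}. a \<notin> N j} \<subseteq> {j\<in>{..<k}. g 0 j \<in> ?M} \<union> {j\<in>{..<k}. g (l - 2) j \<in> ?M}"
        using a gB(2)[of 0] gB(2)[of "l - 2"] l3 by (auto simp: N_def nbhd_def)
    qed auto
    also have "\<dots> \<le> card ?M + card ?M"
      using *[of 0] *[of "l - 2"] l3 by (intro order_trans[OF card_Un_le] add_mono) auto
    finally have "card {j\<in>{..<k}. a \<notin> N j} \<le> 2 * card ?M" by simp
    then have "real (card {j\<in>{..<k}. a \<notin> N j}) \<le> 2 * (\<beta> * n)" using M by linarith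
    then show "card {j\<in>{..<k}. a \<notin> N j} \<le> nat \<lceil>2 * (\<beta> * n)\<rceil>" by linarith
  qed (use finA' in \<open>auto simp: k_def\<close>)
  then obtain h where h: "inj_on h {..<k}" "\<And>j. j < k \<Longrightarrow> h j \<in> N j" by auto
  let ?U2 = "h ` {..<k} \<union> (\<Union>i<l-1. W i)"
  have hA': "h j \<in> A'" if "j < k" for j using h(2)[OF that] by (auto simp: N_def)
  have WB': "(\<Union>i<l-1. W i) \<subseteq> B'" using W(1) by blast
  have A'B: "A' \<inter> B = {}" using A1 AB by (auto simp: A'_def)
  have "packs (G \<union> H) (Suc (l - 1)) k ?U2"
  proof (rule packs_from_chain)
    show "2 \<le> l - 1" using l3 by simp
    show "h j \<notin> W i" if "j < k" "i < l - 1" for j i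
      using hA'[OF that(1)] W(1)[OF that(2)] A'B by (auto simp: B'_def)
    show "{h j, g 0 j} \<in> G \<and> {h j, g (l - 1 - 1) j} \<in> G" if "j < k" for j
      using h(2)[OF that] by (simp add: N_def numeral_2_eq_2)
  qed (use g W(2) h in auto)
  then have U2: "packs (G \<union> H) l k ?U2" using l3 by simp
  have U2s: "?U2 \<subseteq> A' \<union> B'" using hA' WB' by blast
  have "U1 \<inter> (A' \<union> B') = {}" using U1(3) A'B by (auto simp: A'_def B'_def Y_def)
  then have "U1 \<inter> ?U2 = {}" using U2s by blast
  from packs_add[OF U1(1) U2 this] have "packs (G \<union> H) l (card A1) (U1 \<union> ?U2)" using cA1 by simp
  moreover have "(U1 \<union> (A' \<union> B')) \<inter> U0 = {}"
    using U1(3) A1(3) by (auto simp: A'_def B'_def Y_def X_def)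
  then have "(U1 \<union> ?U2) \<inter> U0 = {}" using U2s by blast
  ultimately show ?thesis by blast
qed

end

section \<open>Reservoirs and linking parts\<close>

lemma sum_card_nbhd_swap:
  assumes "finite X" "finite Y"
  shows "(\<Sum>x\<in>X. card (nbhd G x \<inter> Y)) = (\<Sum>y\<in>Y. card (nbhd G y \<inter> X))"
proof -
  have *: "card (nbhd G x \<inter> Y) = (\<Sum>y\<in>Y. of_bool ({x, y} \<in> G))" if "finite Y" for x Y
  proof -
    have "nbhd G x \<inter> Y = {y\<in>Y. {x, y} \<in> G}" by (auto simp: nbhd_def)
    then show ?thesis using that by (simp add: of_bool_def sum.If_cases Int_def)
  qed
  show ?thesis
    unfolding *[OF assms(1)] *[OF assms(2)] by (subst sum.swap) (simp add: insert_commute)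
qed

lemma sum_card_nbhd_le:
  assumes "finite B" "finite G"
  shows "(\<Sum>v\<in>B. card (nbhd G v \<inter> B)) \<le> 2 * card {a\<in>G. a \<subseteq> B}"
proof -
  let ?E = "{a\<in>G. a \<subseteq> B}"
  have "(\<Sum>v\<in>B. card (nbhd G v \<inter> B)) = card (Sigma B (\<lambda>v. nbhd G v \<inter> B))"
    using assms by (intro card_SigmaI[symmetric]) auto
  \<comment> \<open>\<open>G\<close> is any finite family here; the conditions on \<open>a\<close>
    bound each fibre by 2.\<close>
  also have "\<dots> \<le> card (Sigma ?E (\<lambda>a. {v. v \<in> a \<and> card a \<le> 2 \<and> finite a}))"
  proof (rule card_inj_on_le[of "\<lambda>(v, u). ({v, u}, v)"])
    show "inj_on (\<lambda>(v, u). ({v, u}, v)) (Sigma B (\<lambda>v. nbhd G v \<inter> B))"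
      by (auto simp: inj_on_def doubleton_eq_iff)
    show "(\<lambda>(v, u). ({v, u}, v)) ` Sigma B (\<lambda>v. nbhd G v \<inter> B)
       \<subseteq> Sigma ?E (\<lambda>a. {v. v \<in> a \<and> card a \<le> 2 \<and> finite a})"
      by (auto simp: nbhd_def card_insert_if)
    show "finite (Sigma ?E (\<lambda>a. {v. v \<in> a \<and> card a \<le> 2 \<and> finite a}))"
      using assms finite_subset by (intro finite_SigmaI) auto
  qed
  also have "\<dots> = (\<Sum>a\<in>?E. card {v. v \<in> a \<and> card a \<le> 2 \<and> finite a})"
    using assms finite_subset by (intro card_SigmaI) auto
  also have "\<dots> \<le> (\<Sum>a\<in>?E. 2)"
  proof (rule sum_mono)
    fix a
    show "card {v. v \<in> a \<and> card a \<le> 2 \<and> finite a} \<le> 2"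
      by (cases "card a \<le> 2 \<and> finite a") auto
  qed
  finally show ?thesis by simp
qed

context stable_pair
begin

text \<open>The threshold \<open>n / (64 l)\<close> is such that \<open>l d\<close> vertices outside \<open>D\<close> meet at most \<open>d n / 64\<close>
  edges of \<open>G[B]\<close>.\<close>

definition D where "D = {v\<in>B. n \<le> 64 * l * card (nbhd G v \<inter> B)}"
definition B' where "B' = B - D"
text \<open>At most \<open>card A\<close> disjoint cycles meet \<open>A\<close>, so this many of the
  \<open>m\<close> cycles have to lie inside \<open>B\<close>. Truncated subtraction makes it 0 when
  \<open>A\<close> has at least \<open>m\<close> vertices.\<close>

definition d where "d = m - card A"

lemma DB: "D \<subseteq> B" "finite D" "finite B'" "B' \<subseteq> B"
  using fin finite_subset by (auto simp: D_def B'_def)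

lemma no_loop: "x \<notin> nbhd G x"
  using graph by (auto simp: is_graph_def all_pairs_def nbhd_def)

lemma nbhd_subset: "nbhd G v \<subseteq> {..<n}"
  using graph by (auto simp: is_graph_def all_pairs_def nbhd_def doubleton_eq_iff)

lemma finG: "finite G"
  using graph finite_all_pairs finite_subset by (auto simp: is_graph_def)

lemma n_pos: "0 < real n"
  using beta_n by (cases "n = 0") auto

text \<open>Each vertex of \<open>D\<close> has at least \<open>n / (64 * l)\<close> neighbours in
  \<open>B\<close>, while \<open>G[B]\<close> has at most \<open>\<beta> * n^2\<close> edges; so
  \<open>D\<close> has at most \<open>128 * l * \<beta> * n\<close> vertices.\<close>

lemma card_D: "card D \<le> e"
proof -
  have "card D * n \<le> (\<Sum>v\<in>D. 64 * l * card (nbhd G v \<inter> B))"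
    using sum_mono[of D "\<lambda>_. n"] by (simp add: D_def)
  also have "\<dots> \<le> (\<Sum>v\<in>B. 64 * l * card (nbhd G v \<inter> B))"
    using fin DB by (intro sum_mono2) auto
  also have "\<dots> = 64 * l * (\<Sum>v\<in>B. card (nbhd G v \<inter> B))" by (simp add: sum_distrib_left)
  also have "\<dots> \<le> 64 * l * (2 * card {a\<in>G. a \<subseteq> B})"
    using sum_card_nbhd_le[OF fin(2) finG] by (rule mult_left_mono) simp
  finally have "card D * n \<le> 128 * l * card {a\<in>G. a \<subseteq> B}" by (simp add: mult.assoc mult.left_commute)
  then have "real (card D * n) \<le> real (128 * l * card {a\<in>G. a \<subseteq> B})" by (simp only: of_nat_le_iff)
  then have "real (card D) * n \<le> 128 * l * real (card {a\<in>G. a \<subseteq> B})" by simp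
  also have "\<dots> \<le> 128 * l * (\<beta> * n * n)" using edgesB by (intro mult_left_mono) auto
  also have "\<dots> = (128 * (l * (\<beta> * n))) * n" by simp
  finally have "real (card D) \<le> 128 * (l * (\<beta> * n))" using n_pos by (simp only: mult_le_cancel_right_pos)
  then have "real (card D) \<le> e" using scale by linarith
  then show ?thesis by linarith
qed

lemma card_XB: "card XB \<le> \<beta> * n"
  using excB by (simp add: XB_def)

lemma card_B'_XB: "n \<le> 2 * card (B' - XB)"
proof -
  have "card B \<le> card ((B' - XB) \<union> (D \<union> XB))"
    using fin DB by (intro card_mono) (auto simp: B'_def XB_def)
  also have "\<dots> \<le> card (B' - XB) + (card D + card XB)"
    by (meson card_Un_le add_left_mono order_trans)
  finally have "real (card B) \<le> card (B' - XB) + (real (card D) + card XB)" by linarith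
  moreover have "real (card A) + card B = n" using card_AB by linarith
  moreover have "real (card D) \<le> e" using card_D by simp
  ultimately have "real n \<le> 2 * real (card (B' - XB))" using cardA card_XB scale by linarith
  then show ?thesis by linarith
qed

text \<open>\<open>4 * l * K * e\<close> is the total size of the \<open>2 * l\<close>
  reservoirs.\<close>

lemma small_T: "4 * (4 * l * K * e) \<le> card (B' - XB)" "4 * l * K * e \<le> n"
proof -
  have "4 * real (4 * l * K * e) \<le> real (card (B' - XB))" "real (4 * l * K * e) \<le> n"
    using card_B'_XB scale by linarith+
  then show "4 * (4 * l * K * e) \<le> card (B' - XB)" "4 * l * K * e \<le> n" by linarith+
qed

lemma e_le_n: "e \<le> n"
proof -
  have "real e \<le> n" using scale by linarith
  then show ?thesis by simp
qed

text \<open>The last condition keeps most edges of \<open>G[B']\<close> outside the reservoirs. The first \<open>l - 1\<close> reservoirs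
  serve the final covering, the reservoirs \<open>Q l, \<dots>\<close> carry the cycles inside \<open>B\<close>.\<close>

definition reservoirs where
  "reservoirs Q \<longleftrightarrow> (\<forall>i<2*l. Q i \<subseteq> B' - XB \<and> card (Q i) = 2 * K * e) \<and>
     (\<forall>i<2*l. \<forall>j<2*l. i \<noteq> j \<longrightarrow> Q i \<inter> Q j = {}) \<and>
     4 * (\<Sum>v\<in>(\<Union>i<2*l. Q i). card (nbhd G v \<inter> B')) \<le> (\<Sum>v\<in>B'. card (nbhd G v \<inter> B'))"

text \<open>The union \<open>T\<close> is chosen first, with average degree into \<open>B'\<close>
  at most that over \<open>B' - XB\<close>. It takes at most a quarter of \<open>B' - XB\<close>,
  hence at most a quarter of the degree sum, and is then cut into equal parts.\<close>

lemma reservoirs_exist: "\<exists>Q. reservoirs Q"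
proof -
  let ?P = "B' - XB" and ?T = "4 * l * K * e"
  define w where "w v = card (nbhd G v \<inter> B')" for v
  have finP: "finite ?P" using DB by simp
  obtain T where T: "T \<subseteq> ?P" "card T = ?T" "card ?P * sum w T \<le> ?T * sum w ?P"
    using light_subset[OF finP, of ?T w] small_T by auto
  have finT: "finite T" using T finP finite_subset by blast
  have "card T = 2 * l * (2 * K * e)" using T(2) by (simp add: mult.assoc mult.left_commute)
  from split_equal_parts[OF finT this]
  obtain Q where Q: "\<forall>i<2*l. Q i \<subseteq> T \<and> card (Q i) = 2 * K * e" "\<forall>i<2*l. \<forall>j<2*l. i \<noteq> j \<longrightarrow> Q i \<inter> Q j = {}"
    by (elim exE conjE) (rule that)
  have T0: "0 < ?T" using scale K l3 by auto
  have "?T * (4 * sum w T) = 4 * ?T * sum w T" by simp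
  also have "\<dots> \<le> card ?P * sum w T" using small_T by (intro mult_right_mono) auto
  also have "\<dots> \<le> ?T * sum w ?P" by (rule T)
  finally have "4 * sum w T \<le> sum w ?P" using T0 by (simp only: mult_le_cancel1 simp_thms)
  also have "\<dots> \<le> sum w B'" using DB by (intro sum_mono2) auto
  finally have "4 * sum w T \<le> sum w B'" .
  moreover have "sum w (\<Union>i<2*l. Q i) \<le> sum w T" using Q(1) finT by (intro sum_mono2) auto
  ultimately have "4 * sum w (\<Union>i<2*l. Q i) \<le> sum w B'" by linarith
  moreover have "\<forall>i<2*l. Q i \<subseteq> B' - XB \<and> card (Q i) = 2 * K * e" using Q(1) T(1) by (meson subset_trans)
  ultimately have "reservoirs Q" using Q(2) unfolding reservoirs_def w_def by (intro conjI)
  then show ?thesis by (rule exI[of reservoirs Q])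
qed

lemma d_le: "real d \<le> \<beta> * n"
  using m cardA beta_n unfolding d_def by linarith

text \<open>Of at least \<open>m\<close> neighbours, at most \<open>card A\<close> lie in
  \<open>A\<close> and at most \<open>card D\<close> in \<open>D\<close>.\<close>

lemma B_degree:
  assumes "v \<in> B'"
  shows "d - card D \<le> card (nbhd G v \<inter> B')"
proof -
  have "nbhd G v \<subseteq> A \<union> (D \<union> (nbhd G v \<inter> B'))" using nbhd_subset[of v] AB by (auto simp: B'_def)
  then have "card (nbhd G v) \<le> card (A \<union> (D \<union> (nbhd G v \<inter> B')))" using fin DB by (intro card_mono) auto
  also have "\<dots> \<le> card A + (card D + card (nbhd G v \<inter> B'))"
    by (meson card_Un_le add_left_mono order_trans)
  finally have "card (nbhd G v) \<le> card A + (card D + card (nbhd G v \<inter> B'))" .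
  moreover have "m \<le> card (nbhd G v)" using assms AB DB by (intro degree) auto
  ultimately show ?thesis by (simp add: d_def)
qed

text \<open>\<open>V\<close> holds the vertices whose random pairs are exposed last,
  \<open>U\<close> their \<open>G\<close>-neighbours at which the walks start. The inequality
  provides at least \<open>(d - card D) * n / 16\<close> edges of \<open>G\<close> between
  them.\<close>

definition linking_parts where
  "linking_parts Q U V \<longleftrightarrow> U \<subseteq> B' - (\<Union>i<2*l. Q i) \<and> V \<subseteq> B' - (\<Union>i<2*l. Q i) \<and> U \<inter> V = {} \<and>
     (d - card D) * n \<le> 16 * (\<Sum>v\<in>V. card (nbhd G v \<inter> U))"

text \<open>The constant is \<open>16 = 2 * 2 * 4\<close>: \<open>B'\<close> has at least
  \<open>n / 2\<close> vertices, removing the reservoirs keeps at least half of the degree sum, and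
  \<open>large_cut\<close> loses a factor 4.\<close>

lemma linking_parts_exist:
  assumes "reservoirs Q"
  shows "\<exists>U V. linking_parts Q U V"
proof -
  let ?L = "\<Union>i<2*l. Q i"
  let ?X = "B' - ?L"
  let ?w = "\<lambda>v. card (nbhd G v \<inter> B')"
  have LB: "?L \<subseteq> B'" using assms unfolding reservoirs_def by blast
  have finL: "finite ?L" using LB DB finite_subset by blast
  have "(\<Sum>v\<in>B'. ?w v) = (\<Sum>v\<in>?X. ?w v) + (\<Sum>v\<in>?L. ?w v)"
    using LB DB by (simp add: sum.subset_diff)
  also have "(\<Sum>v\<in>?X. ?w v) \<le> (\<Sum>v\<in>?X. card (nbhd G v \<inter> ?X) + card (nbhd G v \<inter> ?L))"
  proof (rule sum_mono)
    fix v
    have "?w v \<le> card ((nbhd G v \<inter> ?X) \<union> (nbhd G v \<inter> ?L))"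
      using DB finL by (intro card_mono) auto
    then show "?w v \<le> card (nbhd G v \<inter> ?X) + card (nbhd G v \<inter> ?L)" using card_Un_le order_trans by blast
  qed
  also have "\<dots> = (\<Sum>v\<in>?X. card (nbhd G v \<inter> ?X)) + (\<Sum>v\<in>?X. card (nbhd G v \<inter> ?L))" by (rule sum.distrib)
  also have "(\<Sum>v\<in>?X. card (nbhd G v \<inter> ?L)) \<le> (\<Sum>v\<in>B'. card (nbhd G v \<inter> ?L))"
    using DB by (intro sum_mono2) auto
  also have "\<dots> = (\<Sum>v\<in>?L. ?w v)" by (rule sum_card_nbhd_swap[OF DB(3) finL])
  finally have 1: "(\<Sum>v\<in>B'. ?w v) \<le> (\<Sum>v\<in>?X. card (nbhd G v \<inter> ?X)) + 2 * (\<Sum>v\<in>?L. ?w v)" by simp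
  have 2: "4 * (\<Sum>v\<in>?L. ?w v) \<le> (\<Sum>v\<in>B'. ?w v)" using assms by (simp add: reservoirs_def)
  have "(d - card D) * n \<le> (d - card D) * (2 * card B')"
  proof (rule mult_left_mono)
    have "card (B' - XB) \<le> card B'" using DB by (intro card_mono) auto
    then show "n \<le> 2 * card B'" using card_B'_XB by linarith
  qed simp
  also have "\<dots> = 2 * (\<Sum>v\<in>B'. d - card D)" by simp
  also have "\<dots> \<le> 2 * (\<Sum>v\<in>B'. ?w v)" by (intro mult_left_mono sum_mono B_degree) auto
  finally have 3: "(d - card D) * n \<le> 2 * (\<Sum>v\<in>B'. ?w v)" .
  obtain U where U: "U \<subseteq> ?X" "(\<Sum>v\<in>?X. card (nbhd G v \<inter> ?X)) \<le> 4 * (\<Sum>v\<in>?X - U. card (nbhd G v \<inter> U))"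
    using large_cut[of ?X G] DB no_loop by auto
  have "(d - card D) * n \<le> 16 * (\<Sum>v\<in>?X - U. card (nbhd G v \<inter> U))" using 1 2 3 U(2) by linarith
  then show ?thesis using U(1) unfolding linking_parts_def by (intro exI[of _ U] exI[of _ "?X - U"]) auto
qed

text \<open>Put \<open>d' = d - card D\<close>. Of at least \<open>d' * n / 16\<close> edges between
  \<open>U\<close> and \<open>V\<close>, the set \<open>Z\<close> meets at most
  \<open>d' * n / 64\<close>, since vertices of \<open>B'\<close> have at most
  \<open>n / (64 * l)\<close> neighbours in \<open>B\<close>. Vertices of \<open>V - Z\<close> with
  fewer than \<open>d' / 128\<close> remaining neighbours account for at most
  \<open>d' * n / 128\<close>. The others, \<open>P\<close>, keep at least
  \<open>5 * d' * n / 128\<close> edges.\<close>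

lemma linking_sources:
  assumes QUV: "linking_parts Q U V" and Z: "Z \<subseteq> {..<n}" "card Z \<le> l * (d - card D)"
  shows "\<exists>S. (\<forall>v\<in>V - Z. S v \<subseteq> nbhd G v \<inter> U - Z \<and> card (S v) \<le> e \<and>
           (card Z + card (S v) \<le> K * card (S v) \<or> S v = {})) \<and>
         5 * (e * (d - card D)) div 128 \<le> (\<Sum>v\<in>V - Z. card (S v))"
proof -
  define d' where "d' = d - card D"
  have UV: "U \<subseteq> B'" "V \<subseteq> B'" "d' * n \<le> 16 * (\<Sum>v\<in>V. card (nbhd G v \<inter> U))" "U \<inter> V = {}"
    using QUV by (auto simp: linking_parts_def d'_def)
  have finUV: "finite U" "finite V" "finite Z" using UV DB Z finite_subset by (blast, blast, blast)
  have light: "64 * l * card (nbhd G v \<inter> Y) \<le> n" if "v \<in> B'" "Y \<subseteq> B'" for v Y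
  proof -
    have "card (nbhd G v \<inter> Y) \<le> card (nbhd G v \<inter> B)" using that(2) DB fin by (intro card_mono) auto
    then have "64 * l * card (nbhd G v \<inter> Y) \<le> 64 * l * card (nbhd G v \<inter> B)" by (rule mult_left_mono) simp
    also have "\<dots> \<le> n" using that(1) by (auto simp: B'_def D_def)
    finally show ?thesis .
  qed
  have light_sum: "64 * l * (\<Sum>v\<in>X. card (nbhd G v \<inter> Y)) \<le> card X * n" if "X \<subseteq> B'" "Y \<subseteq> B'" for X Y
  proof -
    have "64 * l * (\<Sum>v\<in>X. card (nbhd G v \<inter> Y)) = (\<Sum>v\<in>X. 64 * l * card (nbhd G v \<inter> Y))"
      by (simp add: sum_distrib_left)
    also have "\<dots> \<le> (\<Sum>v\<in>X. n)" using that by (intro sum_mono light) auto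
    finally show ?thesis by simp
  qed
  define deg where "deg v = card (nbhd G v \<inter> U - Z)" for v
  have "(\<Sum>v\<in>V. card (nbhd G v \<inter> U)) = (\<Sum>v\<in>V - Z. card (nbhd G v \<inter> U)) + (\<Sum>v\<in>V \<inter> Z. card (nbhd G v \<inter> U))"
    using finUV by (subst sum.union_disjoint[symmetric]) (auto intro!: sum.cong)
  also have "(\<Sum>v\<in>V - Z. card (nbhd G v \<inter> U)) \<le> (\<Sum>v\<in>V - Z. deg v + card (nbhd G v \<inter> (U \<inter> Z)))"
  proof (rule sum_mono)
    fix v
    have "card (nbhd G v \<inter> U) \<le> card ((nbhd G v \<inter> U - Z) \<union> (nbhd G v \<inter> (U \<inter> Z)))"
      using finUV by (intro card_mono) auto
    then show "card (nbhd G v \<inter> U) \<le> deg v + card (nbhd G v \<inter> (U \<inter> Z))"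
      unfolding deg_def using card_Un_le order_trans by blast
  qed
  also have "\<dots> = (\<Sum>v\<in>V - Z. deg v) + (\<Sum>v\<in>V - Z. card (nbhd G v \<inter> (U \<inter> Z)))" by (rule sum.distrib)
  also have "(\<Sum>v\<in>V - Z. card (nbhd G v \<inter> (U \<inter> Z))) = (\<Sum>u\<in>U \<inter> Z. card (nbhd G u \<inter> (V - Z)))"
    using finUV by (intro sum_card_nbhd_swap) auto
  finally have 1: "(\<Sum>v\<in>V. card (nbhd G v \<inter> U)) \<le> (\<Sum>v\<in>V - Z. deg v)
     + (\<Sum>u\<in>U \<inter> Z. card (nbhd G u \<inter> (V - Z))) + (\<Sum>v\<in>V \<inter> Z. card (nbhd G v \<inter> U))" by simp
  let ?a = "\<Sum>u\<in>U \<inter> Z. card (nbhd G u \<inter> (V - Z))" and ?b = "\<Sum>v\<in>V \<inter> Z. card (nbhd G v \<inter> U)"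
  have "64 * l * ?a + 64 * l * ?b \<le> card (U \<inter> Z) * n + card (V \<inter> Z) * n"
    using UV by (intro add_mono light_sum) auto
  also have "\<dots> = card ((U \<inter> Z) \<union> (V \<inter> Z)) * n"
    using UV finUV by (subst card_Un_disjoint) (auto simp: distrib_right)
  also have "\<dots> \<le> (l * d') * n"
  proof (rule mult_right_mono)
    have "card ((U \<inter> Z) \<union> (V \<inter> Z)) \<le> card Z" using finUV by (intro card_mono) auto
    then show "card ((U \<inter> Z) \<union> (V \<inter> Z)) \<le> l * d'" using Z by (simp add: d'_def)
  qed simp
  finally have "l * (64 * (?a + ?b)) \<le> l * (d' * n)" by (simp add: algebra_simps)
  then have 2: "64 * (?a + ?b) \<le> d' * n" using l3 by simp
  have 3: "3 * (d' * n) \<le> 64 * (\<Sum>v\<in>V - Z. deg v)"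
  proof -
    have "3 * x \<le> 64 * s" if "w \<le> s + a + b" "64 * (a + b) \<le> x" "x \<le> 16 * w" for w s a b x :: nat
    proof -
      have "64 * w \<le> 64 * (s + a + b)" using that(1) by (rule mult_left_mono) simp
      moreover have "4 * x \<le> 64 * w" using that(3) by simp
      ultimately show ?thesis using that(2) by (simp add: algebra_simps)
    qed
    from this[OF 1 2 UV(3)] show ?thesis .
  qed
  define P where "P = {v\<in>V - Z. d' \<le> 128 * deg v}"
  have "(\<Sum>v\<in>V - Z. 128 * deg v) \<le> (\<Sum>v\<in>V - Z. (if v \<in> P then 128 * deg v else 0) + d')"
    by (rule sum_mono) (auto simp: P_def)
  also have "\<dots> = (\<Sum>v\<in>P. 128 * deg v) + card (V - Z) * d'"
    using finUV by (simp add: sum.distrib sum.If_cases P_def Int_def conj_commute)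
  also have "card (V - Z) * d' \<le> n * d'"
  proof (rule mult_right_mono)
    have "V - Z \<subseteq> {..<n}" using UV DB AB by auto
    then show "card (V - Z) \<le> n" using card_mono[of "{..<n}" "V - Z"] by simp
  qed simp
  finally have 4: "128 * (\<Sum>v\<in>V - Z. deg v) \<le> 128 * (\<Sum>v\<in>P. deg v) + n * d'"
    by (simp add: sum_distrib_left)
  have 5: "5 * (d' * n) \<le> 128 * (\<Sum>v\<in>P. deg v)" using 3 4 by (simp add: mult.commute[of n])
  \<comment> \<open>Only sets of at most \<open>e\<close> vertices are known to expand, so each
    source set is truncated at size \<open>e\<close>.\<close>
  have "\<exists>S. S \<subseteq> nbhd G v \<inter> U - Z \<and> card S = (if v \<in> P then min (deg v) e else 0)" for v
    using obtain_subset_with_card_n[of "if v \<in> P then min (deg v) e else 0" "nbhd G v \<inter> U - Z"]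
    by (metis deg_def min.cobounded1 le0)
  then obtain S where S: "\<And>v. S v \<subseteq> nbhd G v \<inter> U - Z" "\<And>v. card (S v) = (if v \<in> P then min (deg v) e else 0)"
    by metis
  have "real d \<le> e" using d_le scale by linarith
  then have d'e: "d' \<le> e" by (simp add: d'_def)
  have "card Z + card (S v) \<le> K * card (S v) \<or> S v = {}" for v
  proof (cases "v \<in> P")
    case True
    then have "d' \<le> 128 * min (deg v) e" using d'e by (auto simp: P_def min_def)
    then have "l * d' \<le> l * (128 * min (deg v) e)" by (rule mult_left_mono) simp
    then have "card Z \<le> 128 * l * card (S v)" using Z(2) S(2)[of v] True by (simp add: d'_def algebra_simps)
    then show ?thesis by (simp add: K)
  next
    case False
    have "finite (S v)" using S(1)[of v] finUV by (meson finite_Diff finite_Int finite_subset)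
    then show ?thesis using S(2)[of v] False by simp
  qed
  moreover have "5 * (e * d') div 128 \<le> (\<Sum>v\<in>V - Z. card (S v))"
  proof -
    have "n * (5 * (e * d')) = e * (5 * (d' * n))" by simp
    also have "\<dots> \<le> e * (128 * (\<Sum>v\<in>P. deg v))" using 5 by (rule mult_left_mono) simp
    also have "\<dots> = 128 * (\<Sum>v\<in>P. e * deg v)" by (simp add: sum_distrib_left algebra_simps)
    also have "\<dots> \<le> 128 * (\<Sum>v\<in>P. n * card (S v))"
    proof (intro mult_left_mono sum_mono)
      fix v assume v: "v \<in> P"
      have "nbhd G v \<inter> U - Z \<subseteq> {..<n}" using nbhd_subset by auto
      then have "deg v \<le> n" unfolding deg_def using card_mono[of "{..<n}"] by fastforce
      \<comment> \<open>Both \<open>deg v\<close> and \<open>e\<close> are at most \<open>n\<close>,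
        so truncation at \<open>e\<close> keeps at least the fraction \<open>e / n\<close> of
        \<open>deg v\<close>.\<close>
      then have "e * deg v \<le> n * min (deg v) e" using e_le_n by (cases "deg v \<le> e") (auto simp: min_def mult.commute)
      then show "e * deg v \<le> n * card (S v)" using S(2)[of v] v by simp
    qed simp
    also have "\<dots> = n * (128 * (\<Sum>v\<in>P. card (S v)))" by (simp add: sum_distrib_left algebra_simps)
    finally have "5 * (e * d') \<le> 128 * (\<Sum>v\<in>P. card (S v))" using n_pos by simp
    moreover have "(\<Sum>v\<in>P. card (S v)) \<le> (\<Sum>v\<in>V - Z. card (S v))"
      using finUV by (intro sum_mono2) (auto simp: P_def)
    ultimately show ?thesis by linarith
  qed
  moreover have "card (S v) \<le> e" for v using S(2)[of v] by simp
  ultimately show ?thesis unfolding d'_def using S(1) by (intro exI[of _ S]) blast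
qed

end

section \<open>Cycles that correct the size of A\<close>

context stable_pair
begin

lemma reservoirs_union:
  assumes "reservoirs Q"
  shows "(\<Union>i<l-1. Q i) \<subseteq> B'" "finite (\<Union>i<l-1. Q i)"
    "real (card (\<Union>i<l-1. Q i)) \<le> real (4 * l * K * e)"
proof -
  have QB: "Q i \<subseteq> B'" "card (Q i) = 2 * K * e" if "i < l - 1" for i
  proof -
    have "i < 2 * l" using that by simp
    then have "Q i \<subseteq> B' - XB \<and> card (Q i) = 2 * K * e" using assms unfolding reservoirs_def by blast
    then show "Q i \<subseteq> B'" "card (Q i) = 2 * K * e" by auto
  qed
  show sub: "(\<Union>i<l-1. Q i) \<subseteq> B'" by (rule UN_least) (use QB in simp)
  show "finite (\<Union>i<l-1. Q i)" using sub DB finite_subset by blast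
  have "card (\<Union>i<l-1. Q i) \<le> (\<Sum>i<l-1. card (Q i))" by (rule card_UN_le) simp
  also have "\<dots> = (l - 1) * (2 * K * e)" using QB by simp
  also have "\<dots> \<le> (2 * l) * (2 * K * e)" by (intro mult_right_mono) auto
  finally have "card (\<Union>i<l-1. Q i) \<le> 4 * l * K * e" by (simp add: algebra_simps)
  then show "real (card (\<Union>i<l-1. Q i)) \<le> real (4 * l * K * e)" by (simp only: of_nat_le_iff)
qed

text \<open>First \<open>d - card D\<close> linking cycles are found one by one, with
  \<open>Z\<close> the vertices used so far; then \<open>min (card D) d\<close> cycles get their
  centres in \<open>D\<close>. With truncated subtraction the total is exactly
  \<open>d\<close>.\<close>

lemma cycles_inside_B:
  assumes jn: "joined n H e" and Q: "reservoirs Q" and UV: "linking_parts Q U V"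
    and link: "\<And>Z. card D < d \<Longrightarrow> Z \<subseteq> {..<n} \<Longrightarrow> card Z \<le> l * (d - card D) \<Longrightarrow>
       \<exists>c. is_cycle (G \<union> H) l c \<and> set c \<subseteq> U \<union> V \<union> (\<Union>i<l-2. Q (l + i)) - Z"
  shows "\<exists>U0. packs (G \<union> H) l d U0 \<and> U0 \<subseteq> B \<and> (\<forall>i<l-1. Q i \<inter> U0 = {})"
proof -
  define R where "R = (\<Union>i<l-1. Q i)"
  define Y1 where "Y1 = U \<union> V \<union> (\<Union>i<l-2. Q (l + i))"
  have QB: "Q i \<subseteq> B' - XB" "card (Q i) = 2 * K * e" if "i < 2 * l" for i
    using Q that by (auto simp: reservoirs_def)
  have Qd: "Q i \<inter> Q j = {}" if "i < 2 * l" "j < 2 * l" "i \<noteq> j" for i j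
    using Q that by (simp add: reservoirs_def)
  have Y1: "Y1 \<subseteq> B'" "Y1 \<inter> R = {}"
  proof -
    have 1: "U \<subseteq> B' - (\<Union>i<2*l. Q i)" "V \<subseteq> B' - (\<Union>i<2*l. Q i)" using UV by (auto simp: linking_parts_def)
    have 2: "Q (l + i) \<subseteq> B'" if "i < l - 2" for i
    proof -
      have "l + i < 2 * l" using that by simp
      from QB(1)[OF this] show ?thesis by blast
    qed
    show "Y1 \<subseteq> B'" using 1 2 by (auto simp: Y1_def)
    have "R \<subseteq> (\<Union>i<2*l. Q i)" unfolding R_def by (intro UN_mono) auto
    moreover have "Q (l + i) \<inter> R = {}" if "i < l - 2" for i
    proof -
      have "Q (l + i) \<inter> Q j = {}" if "j < l - 1" for j
        using \<open>i < l - 2\<close> that by (intro Qd) auto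
      then show ?thesis unfolding R_def by blast
    qed
    ultimately show "Y1 \<inter> R = {}" using 1 unfolding Y1_def by blast
  qed
  have "\<exists>U1. packs (G \<union> H) l i U1 \<and> U1 \<subseteq> Y1" if "i \<le> d - card D" for i
    using that
  proof (induction i)
    case 0
    then show ?case using packs_0 by blast
  next
    case (Suc i)
    then obtain U1 where U1: "packs (G \<union> H) l i U1" "U1 \<subseteq> Y1" by auto
    have "card U1 \<le> l * (d - card D)" using packs_card(2)[OF U1(1)] Suc.prems by simp
    moreover have "U1 \<subseteq> {..<n}" using U1(2) Y1(1) DB(4) AB(1) by blast
    moreover have "card D < d" using Suc.prems by simp
    ultimately obtain c where c: "is_cycle (G \<union> H) l c" "set c \<subseteq> Y1 - U1"
      using link[of U1] unfolding Y1_def by blast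
    then have "set c \<inter> U1 = {}" by auto
    from packs_Suc[OF U1(1) c(1) this] show ?case using U1(2) c(2) by (intro exI[of _ "U1 \<union> set c"]) auto
  qed
  then obtain U1 where U1: "packs (G \<union> H) l (d - card D) U1" "U1 \<subseteq> Y1" by blast
  obtain X where X: "X \<subseteq> D" "card X = min (card D) d"
    using obtain_subset_with_card_n[of "min (card D) d" D] by auto
  have finX: "finite X" using X DB finite_subset by blast
  define Y where "Y = B - D - R - U1"
  have "\<exists>U2. packs (G \<union> H) l (card X) U2 \<and> X \<subseteq> U2 \<and> U2 \<subseteq> X \<union> Y"
  proof (rule pack_stars[OF jn _ l3 finX])
    show "1 \<le> e" using scale by simp
    show "Y \<subseteq> {..<n}" "X \<inter> Y = {}" using AB X by (auto simp: Y_def)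
    have finR: "finite R" and cR: "real (card R) \<le> real (4 * l * K * e)"
      unfolding R_def by (rule reservoirs_union[OF Q])+
    have ld: "l * d \<le> l * (\<beta> * n)" using d_le by (auto intro: mult_left_mono)
    have "card U1 \<le> l * d" using packs_card(2)[OF U1(1)] by simp
    then have cU1: "real (card U1) \<le> l * (\<beta> * n)" using ld by linarith
    have cD: "real (card D) \<le> e" using card_D by simp
    fix x assume x: "x \<in> X"
    have "card (nbhd G x \<inter> B) \<le> card ((nbhd G x \<inter> Y) \<union> (D \<union> (R \<union> U1)))"
      using finR packs_card(1)[OF U1(1)] DB fin by (intro card_mono) (auto simp: Y_def)
    also have "\<dots> \<le> card (nbhd G x \<inter> Y) + (card D + (card R + card U1))"
      by (meson card_Un_le add_left_mono order_trans)
    finally have 1: "card (nbhd G x \<inter> B) \<le> card (nbhd G x \<inter> Y) + (card D + (card R + card U1))" .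
    have "(l - 1) * card X \<le> l * d" using X by (intro mult_mono) auto
    then have 2: "real ((l - 1) * card X) \<le> l * (\<beta> * n)" using ld by linarith
    \<comment> \<open>The centre has at least \<open>n / (64 * l)\<close> neighbours in
      \<open>B\<close>, far more than \<open>D\<close>, the reservoirs and the cycles can take
      away.\<close>
    have "n \<le> 64 * l * card (nbhd G x \<inter> B)" using x X by (auto simp: D_def)
    then have "real n \<le> real (64 * l * card (nbhd G x \<inter> B))" by (simp only: of_nat_le_iff)
    then have n1: "real n \<le> 64 * (l * real (card (nbhd G x \<inter> B)))" by simp
    have "3000 * (l * real (4 * l * K * e)) \<le> n" using e_alpha scale by linarith
    then have "3000 * (l * real (4 * l * K * e)) \<le> 64 * (l * real (card (nbhd G x \<inter> B)))" using n1 by linarith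
    then have "real l * (3000 * real (4 * l * K * e)) \<le> real l * (64 * real (card (nbhd G x \<inter> B)))"
      by (simp only: mult.left_commute)
    then have "3000 * real (4 * l * K * e) \<le> 64 * real (card (nbhd G x \<inter> B))" using l3 by simp
    then have "real ((l - 1) * card X + 2 * (l - 1) * e) \<le> card (nbhd G x \<inter> Y)"
      using 1 2 cR cU1 cD scale unfolding of_nat_add by linarith
    then show "(l - 1) * card X + 2 * (l - 1) * e \<le> card (nbhd G x \<inter> Y)" by linarith
  qed
  then obtain U2 where U2: "packs (G \<union> H) l (card X) U2" "U2 \<subseteq> X \<union> Y" by blast
  have "X \<inter> Y1 = {}" using X Y1 by (auto simp: B'_def)
  then have "U1 \<inter> U2 = {}" using U1(2) U2(2) by (auto simp: Y_def)
  from packs_add[OF U1(1) U2(1) this] have "packs (G \<union> H) l d (U1 \<union> U2)"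
    using X(2) by (simp add: min_def split: if_splits)
  moreover have "U1 \<union> U2 \<subseteq> B" using U1(2) U2(2) Y1(1) X(1) DB by (auto simp: Y_def)
  moreover have "R \<inter> (U1 \<union> U2) = {}"
  proof -
    have "R \<subseteq> B'" unfolding R_def by (rule reservoirs_union[OF Q])
    then have "R \<inter> X = {}" using X by (auto simp: B'_def)
    then show ?thesis using U1(2) U2(2) Y1(2) by (auto simp: Y_def)
  qed
  ultimately show ?thesis unfolding R_def by blast
qed

lemma cycles_with_two_in_A:
  assumes jn: "joined n H e" and Q: "reservoirs Q"
    and t: "t \<le> 3 * (\<beta> * n)"
  shows "\<exists>U0. packs (G \<union> H) l t U0 \<and> U0 \<subseteq> {..<n} \<and> card (U0 \<inter> A) = 2 * t \<and> (\<forall>i<l-1. Q i \<inter> U0 = {})"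
proof -
  define R where "R = (\<Union>i<l-1. Q i)"
  have RB: "R \<subseteq> B" and finR: "finite R" and cR: "real (card R) \<le> real (4 * l * K * e)"
    unfolding R_def using reservoirs_union[OF Q] DB by auto
  have "\<exists>U. packs (G \<union> H) l i U \<and> U \<subseteq> {..<n} - R \<and> card (U \<inter> A) = 2 * i" if "i \<le> t" for i
    using that
  proof (induction i)
    case 0
    then show ?case using packs_0 by (intro exI[of _ "{}"]) auto
  next
    case (Suc i)
    then obtain U where U: "packs (G \<union> H) l i U" "U \<subseteq> {..<n} - R" "card (U \<inter> A) = 2 * i" by auto
    have finU: "finite U" using packs_card[OF U(1)] by simp
    have "real i \<le> 3 * (\<beta> * n)" using Suc.prems t by linarith
    then have "real l * real i \<le> real l * (3 * (\<beta> * n))" by (intro mult_left_mono) auto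
    then have cU: "real (card U) \<le> 3 * (l * (\<beta> * n))" using packs_card[OF U(1)] by simp
    let ?S = "A - XA - U"
    have "card A \<le> card (?S \<union> (XA \<union> U))" using fin finU by (intro card_mono) (auto simp: XA_def)
    also have "\<dots> \<le> card ?S + (card XA + card U)" by (meson card_Un_le add_left_mono order_trans)
    finally have "real (card A) \<le> card ?S + (real (card XA) + card U)" by linarith
    then have "2 * real e \<le> card ?S" using cU excA cardA scale unfolding XA_def[symmetric] by linarith
    then have S2: "2 * e \<le> card ?S" by linarith
    then obtain S1 where S1: "S1 \<subseteq> ?S" "card S1 = e" using obtain_subset_with_card_n[of e ?S] by auto
    have "card (?S - S1) = card ?S - e" using S1 finite_subset[OF S1(1)] fin by (subst card_Diff_subset) auto
    then have "e \<le> card (?S - S1)" using S2 by simp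
    moreover have "?S \<subseteq> {..<n}" using AB by auto
    ultimately obtain a a' where a: "a \<in> S1" "a' \<in> ?S - S1" "{a, a'} \<in> H"
      using joinedD[OF jn, of S1 "?S - S1"] S1 by (metis Diff_disjoint Diff_subset order.trans order_refl)
    have aS: "a \<in> ?S" "a' \<in> ?S" "a \<noteq> a'" using a S1 by auto
    let ?Y = "nbhd G a \<inter> nbhd G a' \<inter> B - R - U"
    have miss: "real (card (B - nbhd G x)) \<le> \<beta> * n" if "x \<in> ?S" for x
    proof -
      have "card (B - nbhd G x) = card B - card (nbhd G x \<inter> B)" "card (nbhd G x \<inter> B) \<le> card B"
        using fin card_Diff_subset_Int[of B "nbhd G x"] by (auto simp: Int_commute intro: card_mono)
      moreover have "card B - \<beta> * n \<le> card (nbhd G x \<inter> B)" using that by (auto simp: XA_def)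
      ultimately show ?thesis by linarith
    qed
    have "card B \<le> card (?Y \<union> ((B - nbhd G a) \<union> ((B - nbhd G a') \<union> (R \<union> U))))"
      using fin finU finR by (intro card_mono) auto
    also have "\<dots> \<le> card ?Y + (card (B - nbhd G a) + (card (B - nbhd G a') + (card R + card U)))"
      by (meson card_Un_le add_left_mono order_trans)
    finally have "real (card B) \<le> card ?Y + (real (card (B - nbhd G a)) + (real (card (B - nbhd G a')) + (real (card R) + card U)))"
      by linarith
    moreover have "real (card A) + card B = n" using card_AB by linarith
    ultimately have "2 * real (l * e) \<le> card ?Y"
      using miss[OF aS(1)] miss[OF aS(2)] cR cU cardA scale by linarith
    moreover have "2 * (l - 2) * e \<le> 2 * (l * e)" by simp
    ultimately have "2 * (l - 2) * e \<le> card ?Y" by linarith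
    moreover have "?Y \<subseteq> {..<n}" "1 \<le> l - 2" "1 \<le> e" using AB l3 scale by auto
    ultimately obtain xs where xs: "length xs = l - 2" "distinct xs" "set xs \<subseteq> ?Y" "walk H xs"
      using joined_path[OF jn] by metis
    have ne: "xs \<noteq> []" using xs l3 by auto
    let ?c = "a # a' # xs"
    have cyc: "is_cycle (G \<union> H) l ?c"
    proof (rule is_cycleI)
      show "length ?c = l" using xs l3 by simp
      show "distinct ?c" using xs aS AB by auto
      have "hd xs \<in> ?Y" "last xs \<in> ?Y" using xs(3) ne hd_in_set last_in_set by blast+
      then have "{a', hd xs} \<in> G" "{last xs, a} \<in> G" by (auto simp: nbhd_def insert_commute)
      moreover have "walk (G \<union> H) xs" using xs(4) by (rule successively_mono) auto
      ultimately show "walk (G \<union> H) ?c" "{last ?c, hd ?c} \<in> G \<union> H"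
        using ne a(3) by (auto simp: successively_Cons)
    qed simp
    have dis: "set ?c \<inter> U = {}" using xs(3) aS by auto
    have "set ?c \<inter> A = {a, a'}" using xs(3) aS AB by auto
    then have "card ((U \<union> set ?c) \<inter> A) = card (U \<inter> A \<union> {a, a'})" by (simp only: Int_Un_distrib2)
    also have "\<dots> = card (U \<inter> A) + card {a, a'}" using aS finU by (subst card_Un_disjoint) auto
    finally have "card ((U \<union> set ?c) \<inter> A) = 2 * Suc i" using U(3) aS by simp
    moreover have "U \<union> set ?c \<subseteq> {..<n} - R" using U(2) xs(3) aS AB RB by auto
    ultimately show ?case using packs_Suc[OF U(1) cyc dis] by blast
  qed
  from this[of t] show ?thesis unfolding R_def by blast
qed

lemma many_disjoint_cycles:
  assumes jn: "joined n H e" and Q: "reservoirs Q" and UV: "linking_parts Q U V"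
    and ex: "\<And>i. i < 2 * l \<Longrightarrow> expands n H (Q i) e K"
    and link: "\<And>Z. card D < d \<Longrightarrow> Z \<subseteq> {..<n} \<Longrightarrow> card Z \<le> l * (d - card D) \<Longrightarrow>
       \<exists>c. is_cycle (G \<union> H) l c \<and> set c \<subseteq> U \<union> V \<union> (\<Union>i<l-2. Q (l + i)) - Z"
  shows "has_disjoint_cycles (G \<union> H) l m"
proof -
  \<comment> \<open>Both cases yield the same data: \<open>j\<close> correcting cycles on
    \<open>U0\<close>, and \<open>m - j\<close> vertices \<open>A1\<close> of \<open>A\<close> for
    the remaining cycles, with enough of \<open>B\<close> left over. The bound
    \<open>6 * \<beta> * n\<close> is \<open>3 * \<beta> * n\<close> for the surplus of
    \<open>A\<close> over \<open>m\<close> plus \<open>3 * \<beta> * n\<close> for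
    \<open>j\<close>.\<close>
  have "\<exists>j U0 A1. packs (G \<union> H) l j U0 \<and> (\<forall>i<l-1. Q i \<inter> U0 = {}) \<and> A1 \<subseteq> A \<and> U0 \<inter> A1 = {} \<and>
     j + card A1 = m \<and> j \<le> 3 * (\<beta> * n) \<and> card A \<le> card A1 + 6 * (\<beta> * n) \<and> (l - 1) * card A1 \<le> card (B - U0)"
  proof (cases "card A < m")
    case True
    obtain U0 where U0: "packs (G \<union> H) l d U0" "U0 \<subseteq> B" "\<forall>i<l-1. Q i \<inter> U0 = {}"
      using cycles_inside_B[OF jn Q UV link] by blast
    have dm: "d + card A = m" using True by (simp add: d_def)
    have "card (B - U0) = card B - l * d" using U0(2) packs_card[OF U0(1)] by (simp add: card_Diff_subset)
    moreover have "l * d + l * card A = l * m" using dm by (simp add: distrib_left[symmetric])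
    moreover have "l * m \<le> n" using m(3) by (simp only: of_nat_le_iff)
    moreover have "l * card A = (l - 1) * card A + card A" using l3 by (cases l) auto
    ultimately have "(l - 1) * card A \<le> card (B - U0)" using card_AB by linarith
    moreover have "U0 \<inter> A = {}" using U0(2) AB by auto
    ultimately show ?thesis using U0 dm d_le beta_n by (intro exI[of _ d] exI[of _ U0] exI[of _ A]) auto
  next
    case False
    \<comment> \<open>\<open>t\<close> is the shortage in \<open>B\<close> if all \<open>m\<close>
      cycles had one vertex in \<open>A\<close>; a cycle with two vertices in \<open>A\<close> saves
      one vertex of \<open>B\<close>. Then \<open>m + t\<close> vertices of \<open>A\<close> are
      needed, which \<open>l * m \<le> n\<close> provides.\<close>
    define t where "t = (l - 1) * m - card B"
    have lm: "l * m \<le> n" using m(3) by (simp only: of_nat_le_iff)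
    have lm': "l * m = (l - 1) * m + m" using l3 by (cases l) auto
    have tA: "t + m \<le> card A" using lm lm' card_AB False by (simp add: t_def)
    have Am: "real (card A) - m \<le> 3 * (\<beta> * n)" using cardA m(1) beta_n by linarith
    then have t3: "t \<le> 3 * (\<beta> * n)" using tA by linarith
    obtain U0 where U0: "packs (G \<union> H) l t U0" "U0 \<subseteq> {..<n}" "card (U0 \<inter> A) = 2 * t" "\<forall>i<l-1. Q i \<inter> U0 = {}"
      using cycles_with_two_in_A[OF jn Q t3] by blast
    have finU0: "finite U0" "card U0 = l * t" using packs_card[OF U0(1)] by auto
    have "card (A - U0) = card A - 2 * t"
      using card_Diff_subset_Int[of A U0] fin U0(3) by (simp add: Int_commute)
    then have "m - t \<le> card (A - U0)" using tA by linarith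
    then obtain A1 where A1: "A1 \<subseteq> A - U0" "card A1 = m - t" using obtain_subset_with_card_n by metis
    have tm: "t \<le> m"
    proof -
      have "real t \<le> m" using t3 cardA scale m(1) by linarith
      then show ?thesis by simp
    qed
    have "card U0 = card (U0 \<inter> A) + card (U0 \<inter> B)"
    proof -
      have "U0 = (U0 \<inter> A) \<union> (U0 \<inter> B)" using U0(2) AB by auto
      then have "card U0 = card ((U0 \<inter> A) \<union> (U0 \<inter> B))" by simp
      also have "\<dots> = card (U0 \<inter> A) + card (U0 \<inter> B)" using finU0 AB by (intro card_Un_disjoint) auto
      finally show ?thesis .
    qed
    then have "card (U0 \<inter> B) = (l - 2) * t" using finU0 U0(3) by (simp add: diff_mult_distrib)
    then have "card (B - U0) = card B - (l - 2) * t"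
      using card_Diff_subset_Int[of B U0] fin by (simp add: Int_commute)
    moreover have "(l - 1) * (m - t) + (l - 2) * t \<le> card B"
    proof -
      have "(l - 1) * (m - t) + (l - 1) * t = (l - 1) * m" using tm by (simp add: distrib_left[symmetric])
      moreover have "(l - 1) * t = (l - 2) * t + t" using l3 by (cases "l - 1") auto
      moreover have "t = 0 \<or> (l - 1) * m = card B + t" by (auto simp: t_def)
      moreover have "(l - 1) * m \<le> card B + t" by (simp add: t_def)
      ultimately show ?thesis by linarith
    qed
    ultimately have "(l - 1) * card A1 \<le> card (B - U0)" unfolding A1(2) by linarith
    moreover have "card A \<le> card A1 + 6 * (\<beta> * n)" using A1(2) tm Am t3 by (simp add: of_nat_diff)
    ultimately show ?thesis using U0 A1 tm t3 by (intro exI[of _ t] exI[of _ U0] exI[of _ A1]) auto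
  qed
  then obtain j U0 A1 where *: "packs (G \<union> H) l j U0" "\<And>i. i < l - 1 \<Longrightarrow> Q i \<inter> U0 = {}" "A1 \<subseteq> A" "U0 \<inter> A1 = {}"
     "j + card A1 = m" "j \<le> 3 * (\<beta> * n)" "card A \<le> card A1 + 6 * (\<beta> * n)" "(l - 1) * card A1 \<le> card (B - U0)"
    by blast
  have QB: "Q i \<subseteq> B' - XB \<and> card (Q i) = 2 * K * e" if "i < 2 * l" for i
    using Q that by (simp add: reservoirs_def)
  have Qd: "Q i \<inter> Q j = {}" if "i < 2 * l" "j < 2 * l" "i \<noteq> j" for i j
    using Q that by (simp add: reservoirs_def)
  have "real l * real j \<le> real l * (3 * (\<beta> * n))" using *(6) by (intro mult_left_mono) auto
  then have cU0: "real (card U0) \<le> 3 * (l * (\<beta> * n))" using packs_card[OF *(1)] by simp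
  have "\<exists>U. packs (G \<union> H) l (card A1) U \<and> U \<inter> U0 = {}"
  proof (rule cover_by_disjoint_cycles[OF jn, of Q])
    fix i assume i: "i < l - 1"
    then have "i < 2 * l" by simp
    with i show "Q i \<subseteq> B - XB \<and> card (Q i) = 2 * K * e \<and> expands n H (Q i) e K \<and> Q i \<inter> U0 = {}"
      using QB[of i] ex[of i] *(2)[OF i] DB by auto
  qed (use * cU0 packs_card[OF *(1)] Qd in auto)
  then obtain U1 where U1: "packs (G \<union> H) l (card A1) U1" "U1 \<inter> U0 = {}" by blast
  then have "U0 \<inter> U1 = {}" by auto
  from packs_add[OF *(1) U1(1) this] show ?thesis using *(5) packs_imp_has_disjoint_cycles by simp
qed

end

section \<open>The probability estimate\<close>

text \<open>Failure forces one of three events: a bipartite hole, a reservoir that does not expand,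
  or missing linking cycles despite expansion. They contribute at most \<open>1 / n^2\<close>,
  \<open>2 * l / n\<close> and \<open>1 / n^2\<close>.\<close>

lemma (in stable_pair) prob_disjoint_cycles:
  assumes "dense_gnp n p C" and Ce: "1000 * real l * n \<le> C * e"
  shows "1 - real (2 * l + 2) / n \<le> gnp_prob n p (\<lambda>H. has_disjoint_cycles (G \<union> H) l m)"
proof -
  interpret dense_gnp n p C by fact
  \<comment> \<open>Reservoirs and linking parts depend on \<open>G\<close> alone, so they are fixed
    before the random pairs.\<close>
  obtain Q where Q: "reservoirs Q" using reservoirs_exist by blast
  obtain U V where UV: "linking_parts Q U V" using linking_parts_exist[OF Q] by blast
  have Q1: "Q i \<subseteq> B' - XB" "card (Q i) = 2 * K * e" if "i < 2 * l" for i
  proof -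
    have "Q i \<subseteq> B' - XB \<and> card (Q i) = 2 * K * e" using Q that unfolding reservoirs_def by blast
    then show "Q i \<subseteq> B' - XB" "card (Q i) = 2 * K * e" by auto
  qed
  have Qd: "Q i \<inter> Q j = {}" if "i < 2 * l" "j < 2 * l" "i \<noteq> j" for i j
    using Q that by (simp add: reservoirs_def)
  have B'n: "B' \<subseteq> {..<n}" using DB AB by auto
  let ?P = "edge_prob (all_pairs n) p"
  let ?z = "l * (d - card D)"
  let ?link = "\<lambda>H. \<forall>Z. Z \<subseteq> {..<n} \<and> card Z \<le> ?z \<longrightarrow>
     (\<exists>c. is_cycle (G \<union> H) (l - 2 + 2) c \<and> set c \<subseteq> U \<union> V \<union> (\<Union>i<l-2. Q (l + i)) - Z)"
  let ?F1 = "\<lambda>H. \<not> joined n H e"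
  let ?F2 = "\<lambda>H. \<exists>i\<in>{..<2*l}. \<not> expands n H (Q i) e K"
  let ?F3 = "\<lambda>H. card D < d \<and> (\<forall>i<l-2. expands n H (Q (l + i)) e K) \<and> \<not> ?link H"
  have e1: "1 \<le> real e" "1 \<le> real l" "1 \<le> real K" using scale l3 K by auto
  have n0: "0 \<le> real n" by simp
  have P1: "?P ?F1 \<le> 1 / real n ^ 2"
  proof (rule prob_not_joined)
    have "real (2 * (e + e) + 2) * n \<le> (6 * real e) * n" using e1 by (intro mult_right_mono) auto
    also have "\<dots> \<le> e * (1000 * real l * n)"
    proof -
      have "6 * real n \<le> 1000 * real l * n" using e1 by (intro mult_right_mono) auto
      then have "real e * (6 * real n) \<le> e * (1000 * real l * n)" by (intro mult_left_mono) auto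
      then show ?thesis by (simp only: mult.assoc mult.left_commute)
    qed
    also have "\<dots> \<le> e * (C * e)" using Ce by (intro mult_left_mono) auto
    finally show "real (2 * (e + e) + 2) * n \<le> C * real (e * e)" by (simp add: algebra_simps)
  qed
  have "?P ?F2 \<le> (\<Sum>i\<in>{..<2*l}. ?P (\<lambda>H. \<not> expands n H (Q i) e K))"
    by (rule edge_prob_Ex_le[OF p0 p1 finite_all_pairs]) simp
  \<comment> \<open>A reservoir has \<open>2 * K * e\<close> vertices; a neighbourhood that is too
    small takes at most half of them, so \<open>w = K * e\<close> are missed.\<close>
  also have "\<dots> \<le> (\<Sum>i\<in>{..<2*l}. 1 / real n)"
  proof (rule sum_mono, rule prob_not_expands[where w = "K * e"])
    fix i assume i: "i \<in> {..<2*l}"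
    then show "Q i \<subseteq> {..<n}" "K * e + K * e \<le> card (Q i)" using Q1[of i] B'n by auto
    show "e \<le> n" by (rule e_le_n)
    fix s :: nat assume s: "1 \<le> s"
    have "2 * (s + K * s) + 2 \<le> 6 * (K * s)" using s K by (cases K) auto
    then have "real (2 * (s + K * s) + 2) \<le> real (6 * (K * s))" by (simp only: of_nat_le_iff)
    then have "real (2 * (s + K * s) + 2) * n \<le> real (6 * (K * s)) * n" by (intro mult_right_mono) auto
    also have "\<dots> = real (K * s) * (6 * n)" by simp
    also have "\<dots> \<le> real (K * s) * (C * e)"
    proof (rule mult_left_mono)
      have "6 * real n \<le> 1000 * real l * n" using e1 by (intro mult_right_mono) auto
      then show "real (6 * n) \<le> C * e" using Ce by simp
    qed simp
    finally show "real (2 * (s + K * s) + 2) * n \<le> C * real (s * (K * e))" by (simp add: algebra_simps)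
  qed
  finally have P2: "?P ?F2 \<le> real (2 * l) * (1 / n)" by simp
  have P3: "?P ?F3 \<le> 1 / real n ^ 2"
  proof (cases "card D < d")
    case True
    define x where "x = e * (d - card D)"
    have d1: "1 \<le> real (d - card D)" using True by simp
    have "?P ?F3 \<le> ?P (\<lambda>H. (\<forall>i<l-2. expands n H (Q (l + i)) e K) \<and> \<not> ?link H)"
      by (rule edge_prob_mono[OF p0 p1 finite_all_pairs]) blast
    also have "\<dots> \<le> 1 / real n ^ 2"
    proof (rule prob_no_linking_cycle[where s = "5 * x div 128"])
      show "1 \<le> l - 2" using l3 by simp
      have U: "U \<subseteq> B' - (\<Union>i<2*l. Q i)" "V \<subseteq> B' - (\<Union>i<2*l. Q i)" "U \<inter> V = {}"
        using UV by (auto simp: linking_parts_def)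
      then show "U \<subseteq> {..<n}" "V \<subseteq> {..<n}" "U \<inter> V = {}" using B'n by auto
      show "Q (l + i) \<subseteq> {..<n} \<and> Q (l + i) \<inter> (U \<union> V) = {}" if "i < l - 2" for i
      proof -
        have i: "l + i < 2 * l" using that by simp
        then have "Q (l + i) \<subseteq> (\<Union>i<2*l. Q i)" by blast
        then show ?thesis using U Q1(1)[OF i] B'n by blast
      qed
      show "Q (l + i) \<inter> Q (l + j) = {}" if "i < l - 2" "j < l - 2" "i \<noteq> j" for i j
        using that by (intro Qd) auto
      show "\<exists>S. (\<forall>v\<in>V - Z. S v \<subseteq> nbhd G v \<inter> U - Z \<and> card (S v) \<le> e \<and>
           (card Z + card (S v) \<le> K * card (S v) \<or> S v = {})) \<and> 5 * x div 128 \<le> (\<Sum>v\<in>V - Z. card (S v))"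
        if "Z \<subseteq> {..<n}" "card Z \<le> ?z" for Z
        using linking_sources[OF UV that] unfolding x_def .
      \<comment> \<open>For \<open>x \<ge> 1000\<close>, rounding down in
        \<open>5 * x div 128\<close> costs less than the spare factor 5.\<close>
      have "1000 \<le> real e" using scale by linarith
      then have "1000 \<le> e" by simp
      then have "1000 * 1 \<le> x" unfolding x_def using True by (intro mult_mono) auto
      then have "x \<le> 128 * (5 * x div 128)" by linarith
      then have x: "real x \<le> 128 * real (5 * x div 128)" by linarith
      \<comment> \<open>After multiplication by 128, the choices of \<open>Z\<close> cost at most
        \<open>512 * y\<close>, while the missing pairs supply at least
        \<open>1000 * y\<close>.\<close>
      define y where "y = real l * real (d - card D) * n"
      have "1 * 1 \<le> real l * real (d - card D)" using e1 d1 by (intro mult_mono) auto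
      from mult_right_mono[OF this n0] have y: "n \<le> y" by (simp only: y_def mult_1)
      have "real (2 * ?z + 2) * n = 2 * y + 2 * n" by (simp add: y_def distrib_right)
      then have 1: "128 * (real (2 * ?z + 2) * n) \<le> 512 * y" using y by linarith
      have "(1000 * real l * n) * real (d - card D) \<le> (C * e) * real (d - card D)"
        using Ce by (intro mult_right_mono) auto
      also have "\<dots> = C * real x" by (simp add: x_def)
      also have "\<dots> \<le> C * (128 * real (5 * x div 128))" using x C0 by (intro mult_left_mono) auto
      also have "(1000 * real l * n) * real (d - card D) = 1000 * y" by (simp add: y_def)
      finally have 2: "1000 * y \<le> 128 * (C * real (5 * x div 128))" by simp
      show "real (2 * ?z + 2) * n \<le> C * real (5 * x div 128)" using 1 2 y n0 by linarith
    qed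
    finally show ?thesis .
  next
    case False
    then show ?thesis by (simp add: edge_prob_def)
  qed
  have "?P (\<lambda>H. \<not> has_disjoint_cycles (G \<union> H) l m) \<le> ?P (\<lambda>H. (?F1 H \<or> ?F2 H) \<or> ?F3 H)"
  proof (rule edge_prob_mono[OF p0 p1 finite_all_pairs])
    fix H assume no: "\<not> has_disjoint_cycles (G \<union> H) l m"
    show "(?F1 H \<or> ?F2 H) \<or> ?F3 H"
    proof (rule ccontr)
      assume ok: "\<not> ((?F1 H \<or> ?F2 H) \<or> ?F3 H)"
      then have jn: "joined n H e" and ex: "\<And>i. i < 2 * l \<Longrightarrow> expands n H (Q i) e K" by auto
      have "expands n H (Q (l + i)) e K" if "i < l - 2" for i using that by (intro ex) simp
      then have "card D < d \<Longrightarrow> ?link H" using ok by blast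
      moreover have "l - 2 + 2 = l" using l3 by simp
      ultimately have "\<exists>c. is_cycle (G \<union> H) l c \<and> set c \<subseteq> U \<union> V \<union> (\<Union>i<l-2. Q (l + i)) - Z"
        if "card D < d" "Z \<subseteq> {..<n}" "card Z \<le> ?z" for Z using that by simp
      from many_disjoint_cycles[OF jn Q UV ex this] no show False by blast
    qed
  qed
  also have "\<dots> \<le> ?P (\<lambda>H. ?F1 H \<or> ?F2 H) + ?P ?F3"
    by (rule edge_prob_disj_le[OF p0 p1 finite_all_pairs])
  also have "?P (\<lambda>H. ?F1 H \<or> ?F2 H) \<le> ?P ?F1 + ?P ?F2"
    by (rule edge_prob_disj_le[OF p0 p1 finite_all_pairs])
  finally have "?P (\<lambda>H. \<not> has_disjoint_cycles (G \<union> H) l m) \<le> 1 / real n ^ 2 + real (2 * l) * (1 / n) + 1 / real n ^ 2"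
    using P1 P2 P3 by linarith
  also have "\<dots> \<le> 1 / n + real (2 * l) * (1 / n) + 1 / n"
  proof -
    have "1 / real n ^ 2 \<le> 1 / n" using n2 by (simp add: power2_eq_square field_simps)
    then show ?thesis by linarith
  qed
  also have "\<dots> = real (2 * l + 2) / n" by (simp add: add_divide_distrib)
  finally show ?thesis unfolding gnp_prob_eq edge_prob_not[OF p0 p1 finite_all_pairs, of n "\<lambda>H. has_disjoint_cycles (G \<union> H) l m"]
    by linarith
qed

theorem theorem1p5:
  fixes l :: nat
  assumes "l \<ge> 3"
  shows "\<forall>\<alpha>\<^sub>0::real. 0 < \<alpha>\<^sub>0 \<and> \<alpha>\<^sub>0 \<le> 1 / real l \<longrightarrow>
    (\<exists>\<beta> \<gamma> C::real. 0 < \<beta> \<and> \<beta> < \<alpha>\<^sub>0 \<and> 0 < \<gamma> \<and> 0 < C \<and>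
      (\<forall>\<alpha>::real. \<alpha>\<^sub>0 \<le> \<alpha> \<and> \<alpha> \<le> 1 / real l \<longrightarrow>
        (\<forall>\<epsilon>::real. \<epsilon> > 0 \<longrightarrow> (\<exists>N::nat. \<forall>n\<ge>N. \<forall>G p.
           is_graph n G \<and> real (min_degree n G) \<ge> (\<alpha> - \<gamma>) * n \<and> stable n G \<alpha> \<beta> \<and>
           C * ln (real n) / real n \<le> p \<and> p \<le> 1 \<longrightarrow>
           gnp_prob n p (\<lambda>H. has_disjoint_cycles (G \<union> H) l
              (min (min_degree n G) (nat \<lfloor>\<alpha> * real n\<rfloor>))) \<ge> 1 - \<epsilon>))))"
proof (intro allI impI)
  fix \<alpha>\<^sub>0 :: real
  assume a0: "0 < \<alpha>\<^sub>0 \<and> \<alpha>\<^sub>0 \<le> 1 / real l"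
  define K where "K = 128 * l + 1"
  \<comment> \<open>\<open>e\<close> will be \<open>\<eta> * n\<close> rounded up, at most
    \<open>2 * \<eta> * n\<close>; \<open>8000 = 2 * 4000\<close> then yields \<open>e_alpha\<close>
    for all \<open>\<alpha> \<ge> \<alpha>\<^sub>0\<close>. The values of \<open>\<beta>\<close> and
    \<open>C\<close> are those that \<open>e_beta\<close> and \<open>prob_disjoint_cycles\<close>
    call for.\<close>
  define \<eta> where "\<eta> = \<alpha>\<^sub>0 / (8000 * real l * real l * real K)"
  define \<beta> where "\<beta> = \<eta> / (1000 * real l)"
  define C where "C = 1000 * real l / \<eta>"
  have l: "3 \<le> real l" and K1: "1 \<le> real K" using assms by (auto simp: K_def)
  have "1 * 1 * 1 \<le> (8000 * real l) * real l * real K" using l K1 by (intro mult_mono) auto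
  then have M: "1 \<le> 8000 * real l * real l * real K" by simp
  then have "\<alpha>\<^sub>0 * 1 \<le> \<alpha>\<^sub>0 * (8000 * real l * real l * real K)" using a0 by (intro mult_left_mono) auto
  then have \<eta>: "\<eta> \<le> \<alpha>\<^sub>0" unfolding \<eta>_def using M by (subst pos_divide_le_eq) linarith+
  moreover have "0 < \<eta>" unfolding \<eta>_def using a0 M by (intro divide_pos_pos) linarith+
  ultimately have \<eta>: "0 < \<eta>" "\<eta> \<le> \<alpha>\<^sub>0" by auto
  have \<beta>: "0 < \<beta>" "\<beta> < \<eta>" "1000 * (real l * \<beta>) = \<eta>" using \<eta> l by (auto simp: \<beta>_def field_simps)
  have C: "0 < C" "C * \<eta> = 1000 * real l" using \<eta> l by (auto simp: C_def)
  have main: "\<exists>N::nat. \<forall>n\<ge>N. \<forall>G p.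
           is_graph n G \<and> real (min_degree n G) \<ge> (\<alpha> - \<beta>) * n \<and> stable n G \<alpha> \<beta> \<and>
           C * ln (real n) / real n \<le> p \<and> p \<le> 1 \<longrightarrow>
           gnp_prob n p (\<lambda>H. has_disjoint_cycles (G \<union> H) l
              (min (min_degree n G) (nat \<lfloor>\<alpha> * real n\<rfloor>))) \<ge> 1 - \<epsilon>"
    if \<alpha>: "\<alpha>\<^sub>0 \<le> \<alpha>" "\<alpha> \<le> 1 / real l" and \<epsilon>: "\<epsilon> > 0" for \<alpha> \<epsilon> :: real
  proof -
    \<comment> \<open>The three summands secure \<open>n \<ge> 2\<close>,
      \<open>\<beta> * n \<ge> 1\<close> and \<open>(2 * l + 2) / n \<le> \<epsilon>\<close>,
      uniformly in \<open>G\<close> and \<open>p\<close>.\<close>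
    obtain N :: nat where N: "2 + 1 / \<beta> + real (2 * l + 2) / \<epsilon> \<le> N" using real_arch_simple by blast
    show ?thesis
    proof (intro exI[of _ N] allI impI, elim conjE)
      fix n G p
      assume n: "N \<le> n" and G: "is_graph n G" and deg: "(\<alpha> - \<beta>) * real n \<le> real (min_degree n G)"
        and st: "stable n G \<alpha> \<beta>" and p: "C * ln (real n) / real n \<le> p" "p \<le> 1"
      have "0 < 1 / \<beta>" "0 \<le> real (2 * l + 2) / \<epsilon>" using \<beta> \<epsilon> by auto
      then have n': "2 \<le> real n" "1 / \<beta> \<le> n" "real (2 * l + 2) / \<epsilon> \<le> n" using N n by linarith+
      define m where "m = min (min_degree n G) (nat \<lfloor>\<alpha> * real n\<rfloor>)"
      define e where "e = nat \<lceil>\<eta> * n\<rceil>"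
      have bn: "1 \<le> \<beta> * n" using n'(2) \<beta> by (simp add: divide_simps mult.commute)
      also have "\<beta> * n \<le> \<eta> * n" using \<beta> by (intro mult_right_mono) auto
      finally have en: "1 \<le> \<eta> * n" .
      have e: "\<eta> * n \<le> e" "e \<le> 2 * (\<eta> * n)" using en unfolding e_def by linarith+
      from st obtain A B where AB: "A \<union> B = {..<n}" "A \<inter> B = {}"
        and cA: "(\<alpha> - \<beta>) * real n \<le> real (card A)" "card A \<le> (\<alpha> + \<beta>) * real n"
        and dA: "\<forall>v\<in>A. real (card (nbhd G v \<inter> B)) \<ge> \<alpha> * real n / 4"
        and dB: "\<forall>v\<in>B. real (card (nbhd G v \<inter> A)) \<ge> \<alpha> * real n / 4"
        and xA: "real (card {v\<in>A. real (card (nbhd G v \<inter> B)) < real (card B) - \<beta> * real n}) \<le> \<beta> * real n"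
        and xB: "real (card {v\<in>B. real (card (nbhd G v \<inter> A)) < real (card A) - \<beta> * real n}) \<le> \<beta> * real n"
        and eB: "real (card {e\<in>G. e \<subseteq> B}) \<le> \<beta> * (real n) ^ 2"
        unfolding stable_def by (elim exE conjE) (rule that)
      have \<alpha>n: "0 \<le> \<alpha> * n" using \<alpha> a0 by (intro mult_nonneg_nonneg) auto
      have la: "real l * (\<alpha> * n) \<le> n"
      proof -
        have "real l * \<alpha> \<le> 1" using \<alpha>(2) l by (simp add: field_simps)
        then have "(real l * \<alpha>) * real n \<le> 1 * real n" by (intro mult_right_mono) auto
        then show ?thesis by simp
      qed
      have m_le: "real m \<le> \<alpha> * n" unfolding m_def using \<alpha>n by linarith
      interpret stable_pair n l e K m G A B \<alpha> \<beta>
      proof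
        show "3 \<le> l" by fact
        show "K = 128 * l + 1" by (rule K_def)
        have "1000 * (real l * (\<beta> * n)) = (1000 * (real l * \<beta>)) * n" by simp
        also have "\<dots> = \<eta> * n" by (simp only: \<beta>(3))
        finally show "1000 * (real l * (\<beta> * n)) \<le> e" using e by linarith
        have "1000 * (real l * real (4 * l * K * e)) = (4000 * real l * real l * real K) * e" by simp
        also have "\<dots> \<le> (4000 * real l * real l * real K) * (2 * (\<eta> * n))"
          using e by (intro mult_left_mono) auto
        also have "\<dots> = (\<eta> * (8000 * real l * real l * real K)) * n" by simp
        also have "\<eta> * (8000 * real l * real l * real K) = \<alpha>\<^sub>0" unfolding \<eta>_def using l K1 by simp
        also have "\<alpha>\<^sub>0 * n \<le> \<alpha> * n" using \<alpha> by (intro mult_right_mono) auto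
        finally show "1000 * (real l * real (4 * l * K * e)) \<le> \<alpha> * n" .
        show "\<alpha> * n - \<beta> * n - 1 \<le> m"
        proof -
          have "\<alpha> * n - \<beta> * n \<le> min_degree n G" using deg by (simp add: left_diff_distrib)
          moreover have "\<alpha> * n - 1 \<le> nat \<lfloor>\<alpha> * n\<rfloor>" by linarith
          ultimately show ?thesis unfolding m_def using bn by linarith
        qed
        have "real (l * m) \<le> real l * (\<alpha> * n)" using m_le by (simp add: mult_left_mono)
        then show "l * m \<le> n" using la by linarith
        show "m \<le> card (nbhd G v)" if "v < n" for v
        proof -
          have "min_degree n G \<le> degree G v" unfolding min_degree_def using that by (intro Min_le) auto
          then show ?thesis by (simp add: m_def degree_def)
        qed
        show "card {a\<in>G. a \<subseteq> B} \<le> \<beta> * n * n" using eB by (simp add: power2_eq_square)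
      qed (use G AB cA dA dB xA xB la bn m_le in \<open>auto simp: algebra_simps\<close>)
      have "dense_gnp n p C" using n' p C by unfold_locales auto
      moreover have "1000 * real l * n \<le> C * e"
      proof -
        have "1000 * real l * n = C * (\<eta> * n)" using C(2) by simp
        also have "\<dots> \<le> C * e" using e C by (intro mult_left_mono) auto
        finally show ?thesis .
      qed
      ultimately have "1 - real (2 * l + 2) / n \<le> gnp_prob n p (\<lambda>H. has_disjoint_cycles (G \<union> H) l m)"
        by (rule prob_disjoint_cycles)
      moreover have "real (2 * l + 2) / n \<le> \<epsilon>"
        using n'(1,3) \<epsilon> by (simp add: divide_simps mult.commute)
      ultimately show "1 - \<epsilon> \<le> gnp_prob n p (\<lambda>H. has_disjoint_cycles (G \<union> H) l
              (min (min_degree n G) (nat \<lfloor>\<alpha> * real n\<rfloor>)))" unfolding m_def by linarith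
    qed
  qed
  \<comment> \<open>The witness for \<open>\<gamma>\<close> is \<open>\<beta>\<close> as
    well.\<close>
  show "\<exists>\<beta> \<gamma> C::real. 0 < \<beta> \<and> \<beta> < \<alpha>\<^sub>0 \<and> 0 < \<gamma> \<and> 0 < C \<and>
      (\<forall>\<alpha>::real. \<alpha>\<^sub>0 \<le> \<alpha> \<and> \<alpha> \<le> 1 / real l \<longrightarrow>
        (\<forall>\<epsilon>::real. \<epsilon> > 0 \<longrightarrow> (\<exists>N::nat. \<forall>n\<ge>N. \<forall>G p.
           is_graph n G \<and> real (min_degree n G) \<ge> (\<alpha> - \<gamma>) * n \<and> stable n G \<alpha> \<beta> \<and>
           C * ln (real n) / real n \<le> p \<and> p \<le> 1 \<longrightarrow>
           gnp_prob n p (\<lambda>H. has_disjoint_cycles (G \<union> H) l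
              (min (min_degree n G) (nat \<lfloor>\<alpha> * real n\<rfloor>))) \<ge> 1 - \<epsilon>)))"
  proof (rule exI[of _ \<beta>], rule exI[of _ \<beta>], rule exI[of _ C], intro conjI)
    show "\<beta> < \<alpha>\<^sub>0" using \<beta> \<eta> by linarith
  qed (fact \<beta> C | intro allI impI main; simp)+
qed

end
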